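(* Let $X$ be a non-empty (i.e. non-void) simplicial complex on a finite set $V$ with $L(X)=M(X)$. Suppose there is a weak shelling $\prec$ of $X$ such that $M_{\prec}(X)=M(X)$. Then each of the following holds: (1) $L(X)=1$ if and only if $M(X)=1$ and $X$ is not a simplex. (2) $L(X)=2$ if and only if $M(X)=2$ and $\tilde H_1(X[W])\neq 0$ for some $W\subseteq V$. Moreover, in this case ($L(X)=2$), if $\tilde H_1(X[W])\ne 0$, then $X[W]$ contains an induced cycle which corresponds to a generator of $\tilde H_1(X[W])$. (3) For every integer $k\ge 3$: $L(X)=k$ if and only if $M(X)=k$ and $\tilde H_{k-1}(X[W])\neq 0$ for some $W\subseteq V$. Moreover, in this case ($L(X)=k$), if $\tilde H_{k-1}(X[W])\ne 0$, then $X[W]$ contains an induced subcomplex isomorphic to $\partial\Delta(k+1)$ which corresponds to a generator of $\tilde H_{k-1}(X[W])$. Furthermore, if $L(X)=k$ with $k\ge 2$, then $\dim_{\mathbb{Z}/2\mathbb{Z}}\tilde H_{k-1}(X[W])\le 1$ for every $W\subseteq V$.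
   Context: A simplicial complex $X$ on a finite vertex set $V$ is a collection of subsets of $V$ (faces) closed under taking subsets; facets are the inclusion-maximal faces. The void complex is the one with no faces at all. "A simplex" means a complex of the form $2^U$ for some finite set $U$, including $U=\emptyset$. $\Delta(\sigma)=2^\sigma$ is the simplex on a vertex set $\sigma$; $\Delta(n)$ is a simplex on $n$ vertices, and $\partial\Delta(n)$ is its boundary, i.e. $\Delta(n)$ with its unique facet removed. For $W\subseteq V$, $X[W]=\{F\in X: F\subseteq W\}$ is the induced subcomplex. Homology $\tilde H_i$ is reduced simplicial homology with coefficients in $\mathbb{Z}/2\mathbb{Z}$. $X$ is $d$-Leray ($d\ge0$) if $\tilde H_i(X[W])=0$ for all $i\ge d$ and all $W\subseteq V$; $L(X)$ is the smallest integer $d\ge0$ such that $X$ is $d$-Leray. Definition of $M$: let $\prec:\sigma_1\prec\cdots\prec\sigma_m$ be a linear order of all the facets of $X$ and let $X_j=\bigcup_{i=1}^{j}\Delta(\sigma_i)$. Set $M_\prec(X_1)=1$, and for $j=2,\dots,m$ set $M_\prec(X_j)=M_\prec(X_{j-1})$ if $X_{j-1}\cap\Delta(\sigma_j)$ is a simplex, and $M_\prec(X_j)=M_\prec(X_{j-1})+1$ otherwise. Then $M_\prec(X)=M_\prec(X_m)$, and $M(X)=\min_\prec M_\prec(X)$ over all linear orders $\prec$ of the facets of $X$. Weak shelling: the order $\prec$ is a weak shelling of $X$ if for each $j=2,\dots,m$ there is a vertex $u_j$ such that $X_{j-1}[\sigma_j\setminus\{u_j\}]$ is a simplex (i.e.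 equals $2^U$ for some, possibly empty, $U\subseteq\sigma_j\setminus\{u_j\}$). An induced cycle in $X[W]$ is an induced subcomplex $X[W']$ with $W'\subseteq W$ that is a 1-dimensional complex forming a cycle graph (length at least 3). An induced subcomplex $Y$ of $X[W]$ that is a cycle (resp. isomorphic to $\partial\Delta(k+1)$) "corresponds to a generator" of $\tilde H_1(X[W])$ (resp. $\tilde H_{k-1}(X[W])$) if the $\mathbb{Z}/2\mathbb{Z}$-chain that is the sum of all facets of $Y$ is a cycle whose homology class generates that homology group. *)

theory Defs
  imports
    "HOL-Library.Z2"
    "HOL-Combinatorics.Multiset_Permutations"
    "HOL-Algebra.AbelCoset"
    "HOL-Algebra.Generated_Groups"
    "Jordan_Normal_Form.Missing_VectorSpace"
begin

subsection \<open>Simplicial complexes\<close>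

text \<open>The elements of \<open>V\<close> need not all be faces.  The void complex is \<open>{}\<close>; the complex \<open>{{}}\<close> is
  non-void and is a simplex.\<close>

definition simplicial_complex :: "'a set \<Rightarrow> 'a set set \<Rightarrow> bool" where
  "simplicial_complex V X \<longleftrightarrow> finite V \<and> X \<subseteq> Pow V \<and> (\<forall>F\<in>X. \<forall>G. G \<subseteq> F \<longrightarrow> G \<in> X)"

definition facets :: "'a set set \<Rightarrow> 'a set set" where
  "facets X = {F \<in> X. \<forall>G\<in>X. F \<subseteq> G \<longrightarrow> F = G}"

definition is_simplex :: "'a set set \<Rightarrow> bool" where
  "is_simplex X \<longleftrightarrow> (\<exists>U. finite U \<and> X = Pow U)"

definition induced :: "'a set set \<Rightarrow> 'a set \<Rightarrow> 'a set set" where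
  "induced X W = {F \<in> X. F \<subseteq> W}"

text \<open>\<open>\<partial>\<Delta>(n)\<close>, realised on the vertex set \<open>{0, \<dots>, n - 1}\<close>.\<close>

definition simplex_boundary :: "nat \<Rightarrow> nat set set" where
  "simplex_boundary n = Pow {..<n} - {{..<n}}"

text \<open>The vertices of a complex \<open>X\<close> are the elements of \<open>\<Union>X\<close>.\<close>

definition isomorphic_complexes :: "'a set set \<Rightarrow> 'b set set \<Rightarrow> bool" where
  "isomorphic_complexes X Y \<longleftrightarrow> (\<exists>f. bij_betw f (\<Union>X) (\<Union>Y) \<and> Y = (\<lambda>F. f ` F) ` X)"

definition is_cycle_complex :: "'a set set \<Rightarrow> bool" where
  "is_cycle_complex Y \<longleftrightarrow> (\<exists>vs. distinct vs \<and> length vs \<ge> 3 \<and>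
     Y = {{}} \<union> {{v} | v. v \<in> set vs} \<union>
         {{vs ! i, vs ! ((i + 1) mod length vs)} | i. i < length vs})"


subsection \<open>Reduced simplicial homology over the field with two elements\<close>

abbreviation F2 :: "bit ring" where
  "F2 \<equiv> \<lparr>carrier = UNIV, mult = (*), one = 1, zero = 0, add = (+)\<rparr>"

text \<open>The empty face has dimension \<open>-1\<close>, which is what makes the homology below reduced.\<close>

definition faces_of_dim :: "'a set set \<Rightarrow> int \<Rightarrow> 'a set set" where
  "faces_of_dim X i = {F \<in> X. int (card F) = i + 1}"

text \<open>In a module record the fields \<open>mult\<close> and \<open>one\<close> have no meaning.\<close>

definition chain_space :: "'a set set \<Rightarrow> int \<Rightarrow> (bit, 'a set \<Rightarrow> bit) module" where
  "chain_space X i =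
     \<lparr>carrier = {c. \<forall>F. F \<notin> faces_of_dim X i \<longrightarrow> c F = 0},
      mult = undefined, one = undefined,
      zero = (\<lambda>_. 0), add = (\<lambda>c d F. c F + d F),
      smult = (\<lambda>a c F. a * c F)\<rparr>"

text \<open>The boundary of a chain is given by its coefficients: that of \<open>G\<close> in the boundary of
  \<open>c\<close> is the sum of the values \<open>c F\<close> over all \<open>i\<close>-faces \<open>F\<close> with \<open>G = F - {v}\<close> for some
  vertex \<open>v\<close> of \<open>F\<close>.\<close>

definition boundary :: "'a set set \<Rightarrow> int \<Rightarrow> ('a set \<Rightarrow> bit) \<Rightarrow> ('a set \<Rightarrow> bit)" where
  "boundary X i c = (\<lambda>G. \<Sum>F \<in> {F \<in> faces_of_dim X i. \<exists>v\<in>F. G = F - {v}}. c F)"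

definition cycles :: "'a set set \<Rightarrow> int \<Rightarrow> ('a set \<Rightarrow> bit) set" where
  "cycles X i = {c \<in> carrier (chain_space X i). boundary X i c = (\<lambda>_. 0)}"

definition boundaries :: "'a set set \<Rightarrow> int \<Rightarrow> ('a set \<Rightarrow> bit) set" where
  "boundaries X i = boundary X (i + 1) ` carrier (chain_space X (i + 1))"

definition cycle_space :: "'a set set \<Rightarrow> int \<Rightarrow> (bit, 'a set \<Rightarrow> bit) module" where
  "cycle_space X i = (chain_space X i)\<lparr>carrier := cycles X i\<rparr>"

definition quotient_module :: "('r, 'm) module \<Rightarrow> 'm set \<Rightarrow> ('r, 'm set) module" where
  "quotient_module M N =
     \<lparr>carrier = a_rcosets\<^bsub>M\<^esub> N, mult = undefined, one = undefined,
      zero = N, add = set_add M,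
      smult = (\<lambda>a A. \<Union>x\<in>A. N +>\<^bsub>M\<^esub> (a \<odot>\<^bsub>M\<^esub> x))\<rparr>"

definition homology :: "'a set set \<Rightarrow> int \<Rightarrow> (bit, ('a set \<Rightarrow> bit) set) module" where
  "homology X i = quotient_module (cycle_space X i) (boundaries X i)"

definition homology_class :: "'a set set \<Rightarrow> int \<Rightarrow> ('a set \<Rightarrow> bit) \<Rightarrow> ('a set \<Rightarrow> bit) set" where
  "homology_class X i c = boundaries X i +>\<^bsub>cycle_space X i\<^esub> c"

definition homology_zero :: "'a set set \<Rightarrow> int \<Rightarrow> bool" where
  "homology_zero X i \<longleftrightarrow> carrier (homology X i) = {\<zero>\<^bsub>homology X i\<^esub>}"

definition homology_dim :: "'a set set \<Rightarrow> int \<Rightarrow> nat" where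
  "homology_dim X i = vectorspace.dim F2 (homology X i)"

text \<open>\<open>vectorspace.dim\<close> is only specified for vector spaces, so the following checks that
  \<open>homology X i\<close> is one, and that the boundaries are indeed contained in the cycles.\<close>

context
  notes [simp del] = add_bit_eq_xor mult_bit_eq_and bit_not_zero_iff bit_not_one_iff
begin

lemma boundary_add: "boundary X i (\<lambda>F. c F + d F) = (\<lambda>F. boundary X i c F + boundary X i d F)"
  by (simp add: boundary_def sum.distrib)

lemma boundary_smult: "boundary X i (\<lambda>F. a * c F) = (\<lambda>F. a * boundary X i c F)"
  by (simp add: boundary_def sum_distrib_left)

lemma boundary_chain:
  assumes X: "simplicial_complex V X"
  shows "boundary X (i + 1) c \<in> carrier (chain_space X i)"
proof -
  have empty: "{F \<in> faces_of_dim X (i + 1). \<exists>v\<in>F. G = F - {v}} = {}" if "G \<notin> faces_of_dim X i" for G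
  proof (rule ccontr)
    assume "\<not> ?thesis"
    then obtain F v where F: "F \<in> X" "int (card F) = i + 2" "v \<in> F" "G = F - {v}"
      by (auto simp: faces_of_dim_def)
    have "finite F" using F X unfolding simplicial_complex_def by (meson PowD finite_subset subsetD)
    then have "int (card G) = i + 1" using F card_Suc_Diff1[of F v] by simp
    moreover have "G \<in> X" using X F(1,4) Diff_subset[of F "{v}"] unfolding simplicial_complex_def by metis
    ultimately show False using that by (simp add: faces_of_dim_def)
  qed
  have "boundary X (i + 1) c G = 0" if "G \<notin> faces_of_dim X i" for G
    unfolding boundary_def empty[OF that] by simp
  then show ?thesis by (simp add: chain_space_def)
qed

lemma boundary_boundary:
  assumes X: "simplicial_complex V X"
  shows "boundary X i (boundary X (i + 1) c) = (\<lambda>_. 0)"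
proof
  fix G
  have finX: "finite X" using X unfolding simplicial_complex_def by (meson finite_Pow_iff finite_subset)
  have finF: "finite F" if "F \<in> X" for F
    using that X unfolding simplicial_complex_def by (meson PowD finite_subset subsetD)
  let ?A = "{F \<in> faces_of_dim X i. \<exists>v\<in>F. G = F - {v}}"
  let ?E = "faces_of_dim X (i + 1)"
  let ?P = "\<lambda>F E. \<exists>v\<in>E. F = E - {v}"
  have fin: "finite ?A" "finite ?E" using finX by (auto simp: faces_of_dim_def)
  have ev: "even (card {F \<in> ?A. ?P F E})" if E: "E \<in> ?E" for E
  proof (cases "\<exists>u v. u \<in> E \<and> v \<in> E \<and> u \<noteq> v \<and> G = E - {u, v}")
    case False
    have "{F \<in> ?A. ?P F E} = {}"
    proof (rule ccontr)
      assume "\<not> ?thesis"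
      then obtain u v where "v \<in> E" "u \<in> E - {v}" "G = E - {v} - {u}" by auto
      then show False using False by blast
    qed
    then show ?thesis by (simp only: card.empty) simp
  next
    case True
    then obtain u v where uv: "u \<in> E" "v \<in> E" "u \<noteq> v" "G = E - {u, v}" by auto
    have EX: "E \<in> X" "int (card E) = i + 2" using E by (auto simp: faces_of_dim_def)
    have sub: "E - {w} \<in> faces_of_dim X i" if "w \<in> E" for w
    proof -
      have "int (card (E - {w})) = i + 1"
        using EX finF[OF EX(1)] that card_Suc_Diff1[of E w] by simp
      moreover have "E - {w} \<in> X" using X EX(1) Diff_subset[of E "{w}"] unfolding simplicial_complex_def by metis
      ultimately show ?thesis by (simp add: faces_of_dim_def)
    qed
    have "{F \<in> ?A. ?P F E} = {E - {u}, E - {v}}"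
    proof (intro equalityI subsetI)
      fix F assume "F \<in> {F \<in> ?A. ?P F E}"
      then obtain w z where wz: "w \<in> E" "F = E - {w}" "G = F - {z}" by blast
      have "w \<notin> G" using wz by simp
      then have "w = u \<or> w = v" using uv(4) wz(1) by simp
      then show "F \<in> {E - {u}, E - {v}}" using wz(2) by blast
    next
      fix F assume "F \<in> {E - {u}, E - {v}}"
      then consider "F = E - {u}" | "F = E - {v}" by blast
      then show "F \<in> {F \<in> ?A. ?P F E}"
      proof cases
        case 1
        moreover have "v \<in> F" "G = F - {v}" using uv 1 by auto
        ultimately have "F \<in> ?A" using sub[OF uv(1)] by blast
        then show ?thesis using uv(1) \<open>F = E - {u}\<close> by blast
      next
        case 2
        moreover have "u \<in> F" "G = F - {u}" using uv 2 by auto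
        ultimately have "F \<in> ?A" using sub[OF uv(2)] by blast
        then show ?thesis using uv(2) \<open>F = E - {v}\<close> by blast
      qed
    qed
    moreover have "E - {u} \<noteq> E - {v}" using uv by blast
    ultimately show ?thesis by (simp only: card_2_iff'[symmetric]) (simp add: card_insert_if)
  qed
  have "boundary X i (boundary X (i + 1) c) G = (\<Sum>F\<in>?A. \<Sum>E | E \<in> ?E \<and> ?P F E. c E)"
    by (simp add: boundary_def)
  also have "\<dots> = (\<Sum>E\<in>?E. \<Sum>F | F \<in> ?A \<and> ?P F E. c E)"
    by (rule sum.swap_restrict[OF fin])
  also have "\<dots> = (\<Sum>E\<in>?E. of_nat (card {F \<in> ?A. ?P F E}) * c E)" by (simp only: sum_constant)
  also have "\<dots> = (\<Sum>E\<in>?E. 0)"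
  proof (rule sum.cong[OF refl])
    fix E assume "E \<in> ?E"
    from ev[OF this] obtain k where "card {F \<in> ?A. ?P F E} = 2 * k" by (rule evenE)
    then show "of_nat (card {F \<in> ?A. ?P F E}) * c E = 0"
      by (simp only: of_nat_mult of_nat_numeral bit_2_eq_0 mult_zero_left)
  qed
  finally show "boundary X i (boundary X (i + 1) c) G = 0" by simp
qed

lemma boundaries_subset_cycles:
  "simplicial_complex V X \<Longrightarrow> boundaries X i \<subseteq> cycles X i"
  using boundary_boundary boundary_chain by (fastforce simp: boundaries_def cycles_def)

lemma homology_class_eq: "homology_class X i c = {\<lambda>F. b F + c F | b. b \<in> boundaries X i}"
  by (auto simp: homology_class_def a_r_coset_def' cycle_space_def chain_space_def)

lemma cycles_closed:
  "(\<lambda>_. 0) \<in> cycles X i"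
  "c \<in> cycles X i \<Longrightarrow> d \<in> cycles X i \<Longrightarrow> (\<lambda>F. c F + d F) \<in> cycles X i"
  "c \<in> cycles X i \<Longrightarrow> (\<lambda>F. a * c F) \<in> cycles X i"
  by (auto simp: cycles_def chain_space_def boundary_add boundary_smult) (simp add: boundary_def)

lemma boundaries_closed:
  "(\<lambda>_. 0) \<in> boundaries X i"
  "c \<in> boundaries X i \<Longrightarrow> d \<in> boundaries X i \<Longrightarrow> (\<lambda>F. c F + d F) \<in> boundaries X i"
  "c \<in> boundaries X i \<Longrightarrow> (\<lambda>F. a * c F) \<in> boundaries X i"
proof -
  show "(\<lambda>_. 0) \<in> boundaries X i" unfolding boundaries_def
    by (rule image_eqI[where x = "\<lambda>_. 0"]) (auto simp: boundary_def chain_space_def)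
  show "(\<lambda>F. c F + d F) \<in> boundaries X i" if cd: "c \<in> boundaries X i" "d \<in> boundaries X i"
  proof -
    from cd obtain c' d' where "c' \<in> carrier (chain_space X (i+1))" "d' \<in> carrier (chain_space X (i+1))"
      "c = boundary X (i+1) c'" "d = boundary X (i+1) d'" by (auto simp: boundaries_def)
    then show ?thesis unfolding boundaries_def
      by (intro image_eqI[where x = "\<lambda>F. c' F + d' F"]) (auto simp: boundary_add chain_space_def)
  qed
  show "(\<lambda>F. a * c F) \<in> boundaries X i" if c: "c \<in> boundaries X i"
  proof -
    from c obtain c' where "c' \<in> carrier (chain_space X (i+1))" "c = boundary X (i+1) c'"
      by (auto simp: boundaries_def)
    then show ?thesis unfolding boundaries_def
      by (intro image_eqI[where x = "\<lambda>F. a * c' F"]) (auto simp: boundary_smult chain_space_def)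
  qed
qed

lemma homology_simps:
  "carrier (homology X i) = homology_class X i ` cycles X i"
  "\<zero>\<^bsub>homology X i\<^esub> = homology_class X i (\<lambda>_. 0)"
  "homology_class X i c \<oplus>\<^bsub>homology X i\<^esub> homology_class X i d = homology_class X i (\<lambda>F. c F + d F)"
  "a \<odot>\<^bsub>homology X i\<^esub> homology_class X i c = homology_class X i (\<lambda>F. a * c F)"
proof -
  show "carrier (homology X i) = homology_class X i ` cycles X i"
    by (auto simp: homology_def quotient_module_def A_RCOSETS_def' homology_class_def cycle_space_def)
  show "\<zero>\<^bsub>homology X i\<^esub> = homology_class X i (\<lambda>_. 0)"
    by (auto simp: homology_def quotient_module_def homology_class_eq)
  have dist: "b + b' + (c + d) = (b + c) + (b' + d)" for b b' c d :: bit by (simp add: ac_simps)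
  show "homology_class X i c \<oplus>\<^bsub>homology X i\<^esub> homology_class X i d = homology_class X i (\<lambda>F. c F + d F)"
  proof -
    have "homology_class X i c \<oplus>\<^bsub>homology X i\<^esub> homology_class X i d
       = {\<lambda>F. (b F + c F) + (b' F + d F) | b b'. b \<in> boundaries X i \<and> b' \<in> boundaries X i}"
      unfolding homology_class_eq
      by (fastforce simp: homology_def quotient_module_def set_add_def' cycle_space_def chain_space_def)
    also have "\<dots> = {\<lambda>F. b F + (c F + d F) | b. b \<in> boundaries X i}"
    proof (intro equalityI subsetI)
      fix x assume "x \<in> {\<lambda>F. (b F + c F) + (b' F + d F) | b b'. b \<in> boundaries X i \<and> b' \<in> boundaries X i}"
      then obtain b b' where "b \<in> boundaries X i" "b' \<in> boundaries X i"
        "x = (\<lambda>F. (b F + b' F) + (c F + d F))" by (auto simp: dist)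
      then show "x \<in> {\<lambda>F. b F + (c F + d F) | b. b \<in> boundaries X i}"
        using boundaries_closed(2) by (intro CollectI exI[of _ "\<lambda>F. b F + b' F"]) auto
    next
      fix x assume "x \<in> {\<lambda>F. b F + (c F + d F) | b. b \<in> boundaries X i}"
      then obtain b where "b \<in> boundaries X i" "x = (\<lambda>F. b F + (c F + d F))" by auto
      then show "x \<in> {\<lambda>F. (b F + c F) + (b' F + d F) | b b'. b \<in> boundaries X i \<and> b' \<in> boundaries X i}"
        using boundaries_closed(1)[of X i]
        by (intro CollectI exI[of _ b] exI[of _ "\<lambda>_. 0"]) (auto simp: ac_simps)
    qed
    finally show ?thesis by (simp only: homology_class_eq)
  qed
  show "a \<odot>\<^bsub>homology X i\<^esub> homology_class X i c = homology_class X i (\<lambda>F. a * c F)"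
  proof -
    have "a \<odot>\<^bsub>homology X i\<^esub> homology_class X i c
       = {\<lambda>F. b F + a * (b' F + c F) | b b'. b \<in> boundaries X i \<and> b' \<in> boundaries X i}"
      unfolding homology_class_eq
      by (fastforce simp: homology_def quotient_module_def a_r_coset_def' cycle_space_def chain_space_def)
    also have "\<dots> = {\<lambda>F. b F + a * c F | b. b \<in> boundaries X i}"
    proof (intro equalityI subsetI)
      fix x assume "x \<in> {\<lambda>F. b F + a * (b' F + c F) | b b'. b \<in> boundaries X i \<and> b' \<in> boundaries X i}"
      then obtain b b' where "b \<in> boundaries X i" "b' \<in> boundaries X i"
        "x = (\<lambda>F. (b F + a * b' F) + a * c F)" by (auto simp: distrib_left ac_simps)
      then show "x \<in> {\<lambda>F. b F + a * c F | b. b \<in> boundaries X i}"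
        using boundaries_closed(2)[OF _ boundaries_closed(3)]
        by (intro CollectI exI[of _ "\<lambda>F. b F + a * b' F"]) auto
    next
      fix x assume "x \<in> {\<lambda>F. b F + a * c F | b. b \<in> boundaries X i}"
      then obtain b where "b \<in> boundaries X i" "x = (\<lambda>F. b F + a * c F)" by auto
      then show "x \<in> {\<lambda>F. b F + a * (b' F + c F) | b b'. b \<in> boundaries X i \<and> b' \<in> boundaries X i}"
        using boundaries_closed(1)[of X i]
        by (intro CollectI exI[of _ b] exI[of _ "\<lambda>_. 0"]) auto
    qed
    finally show ?thesis by (simp only: homology_class_eq)
  qed
qed

lemma field_F2: "field F2"
proof (rule cring.cring_fieldI2)
  have "\<exists>y::bit. x + y = 0" for x by (rule exI[of _ "- x"]) simp
  then show "cring F2"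
    by (intro cringI abelian_groupI comm_monoidI) (auto simp: algebra_simps simp del: bit_not_zero_iff)
next
  show "\<exists>b\<in>carrier F2. a \<otimes>\<^bsub>F2\<^esub> b = \<one>\<^bsub>F2\<^esub>" if "a \<noteq> \<zero>\<^bsub>F2\<^esub>" for a
    using that by (cases a) auto
qed simp

lemma homology_vectorspace: "vectorspace F2 (homology X i)"
proof -
  have "module F2 (homology X i)"
  proof (rule module_criteria)
    show "cring F2" using field_F2 by (simp add: field_def domain_def)
    have "c F + c F = 0" for c :: "'a set \<Rightarrow> bit" and F by (cases "c F") auto
    then show "\<forall>v\<in>carrier (homology X i). \<exists>w\<in>carrier (homology X i). v \<oplus>\<^bsub>homology X i\<^esub> w = \<zero>\<^bsub>homology X i\<^esub>"
      by (auto simp: homology_simps intro!: bexI)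
  qed (auto simp: homology_simps cycles_closed algebra_simps)
  then show ?thesis using field_F2 by (simp add: vectorspace_def)
qed

end

definition facet_sum :: "'a set set \<Rightarrow> 'a set \<Rightarrow> bit" where
  "facet_sum Y = (\<lambda>F. if F \<in> facets Y then 1 else 0)"

text \<open>\<open>Y\<close> is meant to be a subcomplex of \<open>X\<close>; membership in \<open>cycles X i\<close> includes that all facets of
  \<open>Y\<close> are \<open>i\<close>-dimensional faces of \<open>X\<close>.\<close>

definition corresponds_to_generator :: "'a set set \<Rightarrow> int \<Rightarrow> 'a set set \<Rightarrow> bool" where
  "corresponds_to_generator X i Y \<longleftrightarrow> facet_sum Y \<in> cycles X i \<and>
     generate (add_monoid (homology X i)) {homology_class X i (facet_sum Y)} =
       carrier (homology X i)"


subsection \<open>The invariants \<open>L\<close> and \<open>M\<close> and weak shellings\<close>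

definition leray :: "'a set \<Rightarrow> nat \<Rightarrow> 'a set set \<Rightarrow> bool" where
  "leray V d X \<longleftrightarrow> (\<forall>i \<ge> int d. \<forall>W \<subseteq> V. homology_zero (induced X W) i)"

definition leray_number :: "'a set \<Rightarrow> 'a set set \<Rightarrow> nat" where
  "leray_number V X = (LEAST d. leray V d X)"

text \<open>A linear order \<open>\<sigma>\<^sub>1, \<dots>, \<sigma>\<^sub>m\<close> of the facets is a list \<open>s\<close> with \<open>\<sigma>\<^sub>j = s ! (j - 1)\<close>.\<close>

definition facet_orders :: "'a set set \<Rightarrow> 'a set list set" where
  "facet_orders X = permutations_of_set (facets X)"

text \<open>\<open>prefix_complex s j\<close> is the union \<open>X\<^sub>j\<close> of the simplices on the first \<open>j\<close> facets.\<close>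

definition prefix_complex :: "'a set list \<Rightarrow> nat \<Rightarrow> 'a set set" where
  "prefix_complex s j = (\<Union>i<j. Pow (s ! i))"

text \<open>\<open>M_prefix s j\<close> is \<open>M\<close> of \<open>X\<^sub>j\<close>; only \<open>j \<ge> 1\<close> is meaningful, the value at \<open>0\<close> is a dummy.\<close>

fun M_prefix :: "'a set list \<Rightarrow> nat \<Rightarrow> nat" where
  "M_prefix s 0 = 0"
| "M_prefix s (Suc 0) = 1"
| "M_prefix s (Suc (Suc j)) =
     (if is_simplex (prefix_complex s (Suc j) \<inter> Pow (s ! Suc j))
      then M_prefix s (Suc j) else M_prefix s (Suc j) + 1)"

definition M_order :: "'a set list \<Rightarrow> nat" where
  "M_order s = M_prefix s (length s)"

definition M_number :: "'a set set \<Rightarrow> nat" where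
  "M_number X = Min (M_order ` facet_orders X)"

definition weak_shelling :: "'a set \<Rightarrow> 'a set set \<Rightarrow> 'a set list \<Rightarrow> bool" where
  "weak_shelling V X s \<longleftrightarrow> s \<in> facet_orders X \<and>
     (\<forall>j\<in>{2..length s}. \<exists>u\<in>V.
        is_simplex (induced (prefix_complex s (j - 1)) (s ! (j - 1) - {u})))"

end

theory Submission
  imports Defs "HOL-Library.Function_Algebras"
begin

text \<open>Call a complex \<open>k\<close>-built if it arises from a simplex by successively attaching simplices
  \<open>s\<close> such that \<open>X[s - {u}]\<close> is a simplex for some \<open>u\<close>, with \<open>k - 1\<close> attachments for which
  \<open>X \<inter> 2\<^sup>s\<close> is not itself a simplex.  This class is closed under induced subcomplexes, and
  Mayer-Vietoris arguments by induction on the construction show that homology vanishes from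
  dimension \<open>k\<close> on, and that in dimension \<open>k - 1\<close> it embeds into the top homology of the
  intersection \<open>K = X \<inter> 2\<^sup>s\<close> at the last non-simplex attachment.  For \<open>k = 2\<close>, \<open>K\<close> is a simplex
  together with the isolated vertex \<open>u\<close>, and a shortest path from \<open>u\<close> to that simplex is closed up to
  an induced cycle.  For \<open>k \<ge> 3\<close> the homology of \<open>K\<close> is generated by some \<open>\<partial>2\<^sup>\<tau>\<close>, which bounds in \<open>X\<close>;
  a second induction shows that then \<open>X\<close> contains a cone \<open>v * \<partial>2\<^sup>\<tau>\<close>, so that \<open>\<tau> \<union> {v}\<close> spans the
  required boundary of a simplex.\<close>

subsection \<open>Chains over the field with two elements\<close>

text \<open>The obstacle is the shape of fillings. A sphere \<partial>2^\<tau> in the interface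
  \<open>K\<close> may bound in \<open>X\<close> by a chain of any shape, but an induced sphere
  arises from adding the face \<tau> only if some filling is a cone. In a 1-built complex no such
  cone need exist, as the ends of a path with three edges show. So the vertex \<open>u\<close> of
  the weak condition has to supply it at the lowest level, where deleting \<open>u\<close> from
  \<open>K\<close> leaves a simplex, and the higher levels inherit it. The same vertex forces an
  induced cycle of \<open>K\<close> to be a triangle. The induction can pass to \<open>K\<close>
  because \<open>K\<close> is the induced subcomplex of \<open>X\<close> on \<open>s\<close>: it has
  the index of \<open>X\<close>, one less than that of the complex after the step. The generator and
  the bound on the dimension both come from injectivity of the connecting map, which sends a cycle
  to the boundary of its part in \<open>X\<close>. The equality of \<open>L\<close> and
  \<open>M\<close> identifies the index with the Leray number, whose minimality provides nonzero
  homology in the top dimension allowed.\<close>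

declare add_bit_eq_xor [simp del] mult_bit_eq_and [simp del]
  bit_not_zero_iff [simp del] bit_not_one_iff [simp del]

lemma bit_add_self [simp]: "x + x = (0::bit)"
  by (cases x) auto

lemma bit_add_self_left [simp]: "x + (x + y) = (y::bit)"
  by (simp flip: add.assoc)

lemma bit_add_eq_0_iff [simp]: "x + y = 0 \<longleftrightarrow> x = (y::bit)"
  by (cases x; cases y) auto

lemma chain_add_self [simp]: "c + c = (0 :: 'b \<Rightarrow> bit)"
  by (simp add: fun_eq_iff)

lemma chain_add_self_left [simp]: "c + (c + d) = (d :: 'b \<Rightarrow> bit)"
  by (simp add: fun_eq_iff)

definition face_chain :: "'a set \<Rightarrow> 'a set \<Rightarrow> bit" where
  "face_chain F = (\<lambda>G. if G = F then 1 else 0)"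

definition restrict_chain :: "'a set set \<Rightarrow> ('a set \<Rightarrow> bit) \<Rightarrow> 'a set \<Rightarrow> bit" where
  "restrict_chain X c = (\<lambda>F. if F \<in> X then c F else 0)"

text \<open>Chains are indexed by the cardinality of their faces, one more than the dimension.\<close>

definition chains :: "'a set set \<Rightarrow> nat \<Rightarrow> ('a set \<Rightarrow> bit) set" where
  "chains X n = {c. \<forall>F. c F \<noteq> 0 \<longrightarrow> F \<in> X \<and> card F = n}"

text \<open>This is the join of \<open>c\<close> with the point \<open>p\<close>. Faces of
  \<open>c\<close> that already contain \<open>p\<close> contribute nothing, since
  \<open>F - {p}\<close> never contains \<open>p\<close>; degenerate joins thus count as
  zero.\<close>

definition cone :: "'a \<Rightarrow> ('a set \<Rightarrow> bit) \<Rightarrow> 'a set \<Rightarrow> bit" where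
  "cone p c = (\<lambda>F. if p \<in> F then c (F - {p}) else 0)"

lemma chainsI: "(\<And>F. c F \<noteq> 0 \<Longrightarrow> F \<in> X \<and> card F = n) \<Longrightarrow> c \<in> chains X n"
  by (simp add: chains_def)

lemma chains_add [intro]: "c \<in> chains X n \<Longrightarrow> d \<in> chains X n \<Longrightarrow> c + d \<in> chains X n"
  by (auto simp: chains_def) (metis add.right_neutral)+

lemma chains_0 [intro, simp]: "0 \<in> chains X n"
  by (simp add: chains_def)

lemma chains_mono: "X \<subseteq> Y \<Longrightarrow> chains X n \<subseteq> chains Y n"
  by (auto simp: chains_def)

lemma chainsD: "c \<in> chains X n \<Longrightarrow> c F \<noteq> 0 \<Longrightarrow> F \<in> X"
  by (auto simp: chains_def)

lemma face_chain_chains [intro]: "F \<in> X \<Longrightarrow> card F = n \<Longrightarrow> face_chain F \<in> chains X n"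
  by (auto simp: chains_def face_chain_def)

lemma face_chain_self [simp]: "face_chain F F = 1"
  by (simp add: face_chain_def)

text \<open>The faces common to \<open>X\<close> and \<open>Y\<close> all go to the \<open>X\<close>
  part. Over the field with two elements the remaining part is a sum.\<close>

lemma restrict_chain_chains:
  "c \<in> chains (X \<union> Y) n \<Longrightarrow> restrict_chain X c \<in> chains X n"
  "c \<in> chains (X \<union> Y) n \<Longrightarrow> c + restrict_chain X c \<in> chains Y n"
  unfolding chains_def restrict_chain_def by auto

lemma restrict_chain_add: "restrict_chain X (c + d) = restrict_chain X c + restrict_chain X d"
  by (simp add: restrict_chain_def fun_eq_iff)

text \<open>Each unordered pair is counted twice, so its two equal terms cancel. This gives
  \<partial>\<partial> = 0.\<close>

lemma sum_pairs_bit: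
  assumes "finite A" and comm: "\<And>v w. f v w = (f w v :: bit)"
  shows "(\<Sum>v\<in>A. \<Sum>w\<in>A - {v}. f v w) = 0"
  using assms(1)
proof induction
  case (insert a A)
  have 1: "(\<Sum>w\<in>insert a A - {v}. f v w) = f v a + (\<Sum>w\<in>A - {v}. f v w)" if "v \<in> A" for v
  proof -
    have "insert a A - {v} = insert a (A - {v})" using that insert.hyps by blast
    then show ?thesis using insert.hyps by (simp add: sum.insert)
  qed
  have 2: "insert a A - {a} = A" using insert.hyps by blast
  have "(\<Sum>v\<in>insert a A. \<Sum>w\<in>insert a A - {v}. f v w)
      = (\<Sum>w\<in>A. f a w) + (\<Sum>v\<in>A. \<Sum>w\<in>insert a A - {v}. f v w)"
    by (simp only: sum.insert insert.hyps 2 if_False not_False_eq_True)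
  also have "(\<Sum>v\<in>A. \<Sum>w\<in>insert a A - {v}. f v w) = (\<Sum>v\<in>A. f v a + (\<Sum>w\<in>A - {v}. f v w))"
    by (rule sum.cong[OF refl 1])
  also have "\<dots> = (\<Sum>v\<in>A. f v a)" by (simp only: sum.distrib insert.IH add_0_right)
  also have "(\<Sum>v\<in>A. f v a) = (\<Sum>w\<in>A. f a w)" by (simp only: comm[of _ a])
  finally show ?case by (simp only: bit_add_self)
qed simp

locale finite_vertices =
  fixes V :: "'a set"
  assumes finite_V: "finite V"
begin

text \<open>The sum refers to neither a complex nor a dimension. On chains of a complex the extra
  terms vanish, so chains of \<open>X\<close>, of \<open>Pow s\<close> and of their intersection
  share one boundary map, as Mayer-Vietoris arguments require.\<close>

definition bd :: "('a set \<Rightarrow> bit) \<Rightarrow> 'a set \<Rightarrow> bit" where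
  "bd c = (\<lambda>G. \<Sum>v\<in>V - G. c (insert v G))"

abbreviation cpx :: "'a set set \<Rightarrow> bool" where
  "cpx X \<equiv> simplicial_complex V X"

lemma cpx_finite: "cpx X \<Longrightarrow> F \<in> X \<Longrightarrow> finite F"
  unfolding simplicial_complex_def by (meson PowD finite_subset subsetD)

lemma cpx_down: "cpx X \<Longrightarrow> F \<in> X \<Longrightarrow> G \<subseteq> F \<Longrightarrow> G \<in> X"
  unfolding simplicial_complex_def by blast

lemma cpx_vertices: "cpx X \<Longrightarrow> F \<in> X \<Longrightarrow> F \<subseteq> V"
  unfolding simplicial_complex_def by blast

lemma cpx_Pow: "U \<subseteq> V \<Longrightarrow> cpx (Pow U)"
  unfolding simplicial_complex_def using finite_V by auto

lemma cpx_Un: "cpx X \<Longrightarrow> cpx Y \<Longrightarrow> cpx (X \<union> Y)"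
  by (simp add: simplicial_complex_def ball_Un)

lemma cpx_induced: "cpx X \<Longrightarrow> cpx (induced X W)"
  unfolding simplicial_complex_def induced_def by (auto intro: subset_trans)

lemma bd_add [simp]: "bd (c + d) = bd c + bd d"
  by (simp add: bd_def fun_eq_iff sum.distrib)

lemma bd_0 [simp]: "bd 0 = 0"
  by (simp add: bd_def fun_eq_iff)

lemma bd_chains:
  assumes X: "cpx X" and c: "c \<in> chains X (Suc n)"
  shows "bd c \<in> chains X n"
proof (rule chainsI)
  fix G assume "bd c G \<noteq> 0"
  then obtain v where v: "v \<in> V - G" "c (insert v G) \<noteq> 0"
    unfolding bd_def by (meson sum.not_neutral_contains_not_neutral)
  then have *: "insert v G \<in> X" "card (insert v G) = Suc n" using c by (auto simp: chains_def)
  then have "finite G" using cpx_finite[OF X] by (metis finite_insert)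
  with * v show "G \<in> X \<and> card G = n" using cpx_down[OF X] by auto
qed

lemma bd_bd [simp]: "bd (bd c) = 0"
proof
  fix G
  have "bd (bd c) G = (\<Sum>v\<in>V - G. \<Sum>w\<in>V - G - {v}. c (insert w (insert v G)))"
    unfolding bd_def by (intro sum.cong refl) auto
  also have "\<dots> = 0"
    by (rule sum_pairs_bit) (auto simp: finite_V insert_commute)
  finally show "bd (bd c) G = 0 G" by simp
qed

lemma cone_chains:
  assumes "c \<in> chains X n" "\<And>F. F \<in> X \<Longrightarrow> p \<notin> F \<Longrightarrow> insert p F \<in> Y" "\<And>F. F \<in> X \<Longrightarrow> finite F"
  shows "cone p c \<in> chains Y (Suc n)"
proof (rule chainsI)
  fix F assume "cone p c F \<noteq> 0"
  then have *: "p \<in> F" "F - {p} \<in> X" "card (F - {p}) = n"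
    using assms(1) by (auto simp: cone_def chains_def split: if_splits)
  moreover have "F = insert p (F - {p})" using * by blast
  ultimately show "F \<in> Y \<and> card F = Suc n"
    using assms(2)[of "F - {p}"] assms(3)[of "F - {p}"] card_insert_disjoint[of "F - {p}" p] by auto
qed

text \<open>The cone operator is a contracting homotopy. At a face \<open>G\<close> containing
  \<open>p\<close>, the term \<open>c G\<close> reappears in \<open>bd c (G - {p})\<close> as the
  one that adds \<open>p\<close> back, and the two cancel.\<close>

lemma bd_cone:
  assumes p: "p \<in> V"
  shows "bd (cone p c) = c + cone p (bd c)"
proof
  fix G
  show "bd (cone p c) G = (c + cone p (bd c)) G"
  proof (cases "p \<in> G")
    case False
    have "bd (cone p c) G = (\<Sum>v\<in>V - G. if v = p then c G else 0)"
      unfolding bd_def cone_def using False by (intro sum.cong) auto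
    then show ?thesis using False p finite_V by (simp add: cone_def)
  next
    case True
    have "V - (G - {p}) = insert p (V - G)" using True p by auto
    then have "bd c (G - {p}) = c (insert p (G - {p})) + (\<Sum>v\<in>V - G. c (insert v (G - {p})))"
      unfolding bd_def using True finite_V by simp
    also have "insert p (G - {p}) = G" using True by blast
    also have "(\<Sum>v\<in>V - G. c (insert v (G - {p}))) = bd (cone p c) G"
      unfolding bd_def cone_def using True by (intro sum.cong) (auto simp: insert_Diff_if)
    finally show ?thesis using True by (simp add: cone_def)
  qed
qed

section \<open>Mayer-Vietoris for the attachment of one simplex\<close>

definition bounding :: "'a set set \<Rightarrow> nat \<Rightarrow> ('a set \<Rightarrow> bit) set" where
  "bounding X n = bd ` chains X (Suc n)"

text \<open>Since \<open>n\<close> counts vertices, this concerns reduced homology in dimension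
  \<open>n - 1\<close>.\<close>

definition acyclic_at :: "'a set set \<Rightarrow> nat \<Rightarrow> bool" where
  "acyclic_at X n \<longleftrightarrow> (\<forall>z\<in>chains X n. bd z = 0 \<longrightarrow> z \<in> bounding X n)"

text \<open>Over the field with two elements the multiples of a class are zero and the class itself,
  so two alternatives suffice. The chain \<open>g\<close> may itself bound; then the homology is
  zero.\<close>

definition generator :: "'a set set \<Rightarrow> nat \<Rightarrow> ('a set \<Rightarrow> bit) \<Rightarrow> bool" where
  "generator X n g \<longleftrightarrow> g \<in> chains X n \<and> bd g = 0 \<and>
     (\<forall>z\<in>chains X n. bd z = 0 \<longrightarrow> z \<in> bounding X n \<or> z + g \<in> bounding X n)"

lemma bounding_add: "c \<in> bounding X n \<Longrightarrow> d \<in> bounding X n \<Longrightarrow> c + d \<in> bounding X n"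
proof -
  assume "c \<in> bounding X n" "d \<in> bounding X n"
  then obtain c' d' where "c' \<in> chains X (Suc n)" "d' \<in> chains X (Suc n)" "c = bd c'" "d = bd d'"
    unfolding bounding_def by blast
  then show ?thesis unfolding bounding_def by (intro image_eqI[of _ _ "c' + d'"]) auto
qed

lemma bounding_mono: "X \<subseteq> Y \<Longrightarrow> bounding X n \<subseteq> bounding Y n"
  unfolding bounding_def by (intro image_mono chains_mono)

lemma bounding_0 [simp, intro]: "0 \<in> bounding X n"
  unfolding bounding_def by (metis bd_0 chains_0 imageI)

text \<open>A cone from any vertex of \<open>U\<close> fills the cycle. The bound on
  \<open>n\<close> excludes dimension -1, where the empty face is a cycle of \<open>Pow {}\<close>
  that bounds nothing.\<close>

lemma acyclic_simplex:
  assumes U: "U \<subseteq> V" and n: "n \<ge> 1"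
  shows "acyclic_at (Pow U) n"
  unfolding acyclic_at_def
proof (intro ballI impI)
  fix z assume z: "z \<in> chains (Pow U) n" "bd z = 0"
  have finU: "finite U" using U finite_V finite_subset by blast
  show "z \<in> bounding (Pow U) n"
  proof (cases "U = {}")
    case True
    then have "z = 0" using z n by (fastforce simp: chains_def fun_eq_iff)
    then show ?thesis by simp
  next
    case False
    then obtain p where p: "p \<in> U" by blast
    have "cone p z \<in> chains (Pow U) (Suc n)"
      by (rule cone_chains[OF z(1)]) (use p finU in \<open>auto intro: finite_subset\<close>)
    moreover have "bd (cone p z) = z" using bd_cone[of p z] p U z(2) by (auto simp: cone_def fun_eq_iff)
    ultimately show ?thesis unfolding bounding_def by (metis imageI)
  qed
qed

text \<open>This is the connecting map on chains. The part of \<open>z\<close> outside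
  \<open>X\<close> is a chain of \<open>Pow s\<close>, so its boundary is one too; that boundary is
  also \<open>bd z + bd (restrict_chain X z)\<close>, a chain of \<open>X\<close>. Allowing
  \<open>bd z\<close> to be a chain of \<open>X\<close> covers fillings as well as cycles.\<close>

lemma interface_chain:
  assumes X: "cpx X" and s: "s \<subseteq> V" and z: "z \<in> chains (X \<union> Pow s) (Suc n)" "bd z \<in> chains X n"
  shows "bd (z + restrict_chain X z) \<in> chains (X \<inter> Pow s) n"
proof -
  have "bd (z + restrict_chain X z) \<in> chains (Pow s) n"
    using bd_chains[OF cpx_Pow[OF s]] restrict_chain_chains[OF z(1)] by blast
  moreover have "bd (z + restrict_chain X z) \<in> chains X n"
    using bd_chains[OF X] restrict_chain_chains[OF z(1)] z(2) by (simp add: chains_add)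
  ultimately show ?thesis by (auto simp: chains_def)
qed

lemma interface_cycle:
  assumes "cpx X" "s \<subseteq> V" "z \<in> chains (X \<union> Pow s) (Suc n)" "bd z = 0"
  shows "bd (restrict_chain X z) \<in> chains (X \<inter> Pow s) n"
  using interface_chain[of X s z n] assms by simp

text \<open>A filling \<open>w\<close> of the interface cycle closes off both halves of
  \<open>z\<close>: one becomes a cycle of \<open>X\<close>, the other a cycle of the simplex on
  \<open>s\<close>, which bounds.\<close>

lemma homologous_into:
  assumes X: "cpx X" and s: "s \<subseteq> V" and z: "z \<in> chains (X \<union> Pow s) (Suc n)" "bd z = 0"
    and b: "bd (restrict_chain X z) \<in> bounding (X \<inter> Pow s) n"
  obtains z' where "z' \<in> chains X (Suc n)" "bd z' = 0" "z + z' \<in> bounding (X \<union> Pow s) (Suc n)"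
proof -
  obtain w where w: "w \<in> chains (X \<inter> Pow s) (Suc n)" "bd w = bd (restrict_chain X z)"
    using b unfolding bounding_def by force
  then have w': "w \<in> chains X (Suc n)" "w \<in> chains (Pow s) (Suc n)"
    using chains_mono[of "X \<inter> Pow s"] by blast+
  have "z + restrict_chain X z + w \<in> bounding (Pow s) (Suc n)"
    using acyclic_simplex[OF s, of "Suc n"] restrict_chain_chains[OF z(1)] w'(2) w(2) z(2)
    unfolding acyclic_at_def by (simp add: chains_add)
  then have "z + (restrict_chain X z + w) \<in> bounding (X \<union> Pow s) (Suc n)"
    using bounding_mono[of "Pow s" "X \<union> Pow s"] by (auto simp: add.assoc)
  moreover have "restrict_chain X z + w \<in> chains X (Suc n)"
    using restrict_chain_chains[OF z(1)] w'(1) by blast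
  moreover have "bd (restrict_chain X z + w) = 0" using w(2) by simp
  ultimately show thesis using that by blast
qed

lemma bounding_glue:
  assumes X: "cpx X" and s: "s \<subseteq> V" and ac: "acyclic_at X (Suc n)"
    and z: "z \<in> chains (X \<union> Pow s) (Suc n)" "bd z = 0"
    and b: "bd (restrict_chain X z) \<in> bounding (X \<inter> Pow s) n"
  shows "z \<in> bounding (X \<union> Pow s) (Suc n)"
proof -
  obtain z' where "z' \<in> chains X (Suc n)" "bd z' = 0" and b: "z + z' \<in> bounding (X \<union> Pow s) (Suc n)"
    using homologous_into[OF X s z b] .
  then have "z' \<in> bounding X (Suc n)" using ac unfolding acyclic_at_def by blast
  then have "z' \<in> bounding (X \<union> Pow s) (Suc n)" using bounding_mono[of X "X \<union> Pow s"] by blast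
  from bounding_add[OF b this] show ?thesis by (simp add: add.assoc)
qed

lemma acyclic_glue:
  assumes X: "cpx X" and s: "s \<subseteq> V" and "acyclic_at X (Suc n)" "acyclic_at (X \<inter> Pow s) n"
  shows "acyclic_at (X \<union> Pow s) (Suc n)"
  unfolding acyclic_at_def
proof (intro ballI impI)
  fix z assume z: "z \<in> chains (X \<union> Pow s) (Suc n)" "bd z = 0"
  have "bd (restrict_chain X z) \<in> bounding (X \<inter> Pow s) n"
    using assms(4) interface_cycle[OF X s z] unfolding acyclic_at_def by simp
  then show "z \<in> bounding (X \<union> Pow s) (Suc n)"
    using bounding_glue[OF X s assms(3) z] by blast
qed

text \<open>When \<open>X\<close> is acyclic in this degree, the connecting map is injective on
  homology, so a cycle that it sends to a generator is a generator.\<close>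

lemma generator_glue:
  assumes X: "cpx X" and s: "s \<subseteq> V" and ac: "acyclic_at X (Suc n)"
    and g: "g \<in> chains (X \<union> Pow s) (Suc n)" "bd g = 0"
    and gen: "generator (X \<inter> Pow s) n (bd (restrict_chain X g))"
  shows "generator (X \<union> Pow s) (Suc n) g"
  unfolding generator_def
proof (intro conjI ballI impI g)
  fix z assume z: "z \<in> chains (X \<union> Pow s) (Suc n)" "bd z = 0"
  have "bd (restrict_chain X z) \<in> bounding (X \<inter> Pow s) n \<or>
      bd (restrict_chain X (z + g)) \<in> bounding (X \<inter> Pow s) n"
    using gen interface_cycle[OF X s z] unfolding generator_def
    by (simp add: restrict_chain_add)
  then show "z \<in> bounding (X \<union> Pow s) (Suc n) \<or> z + g \<in> bounding (X \<union> Pow s) (Suc n)"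
    using bounding_glue[OF X s ac, of z] bounding_glue[OF X s ac, of "z + g"] z g
    by (auto simp: chains_add)
qed

text \<open>An acyclic intersection lets every cycle be moved into \<open>X\<close> within its
  homology class.\<close>

lemma generator_glue_simplex:
  assumes X: "cpx X" and s: "s \<subseteq> V" and ac: "acyclic_at (X \<inter> Pow s) n"
    and gen: "generator X (Suc n) g"
  shows "generator (X \<union> Pow s) (Suc n) g"
  unfolding generator_def
proof (intro conjI ballI impI)
  show "g \<in> chains (X \<union> Pow s) (Suc n)" "bd g = 0"
    using gen chains_mono[of X "X \<union> Pow s"] unfolding generator_def by blast+
  fix z assume z: "z \<in> chains (X \<union> Pow s) (Suc n)" "bd z = 0"
  have "bd (restrict_chain X z) \<in> bounding (X \<inter> Pow s) n"
    using ac interface_cycle[OF X s z] unfolding acyclic_at_def by simp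
  then obtain z' where z': "z' \<in> chains X (Suc n)" "bd z' = 0"
    and b: "z + z' \<in> bounding (X \<union> Pow s) (Suc n)"
    using homologous_into[OF X s z] by blast
  have "z' \<in> bounding X (Suc n) \<or> z' + g \<in> bounding X (Suc n)"
    using gen z' unfolding generator_def by blast
  then have "z' \<in> bounding (X \<union> Pow s) (Suc n) \<or> z' + g \<in> bounding (X \<union> Pow s) (Suc n)"
    using bounding_mono[of X "X \<union> Pow s"] by blast
  then show "z \<in> bounding (X \<union> Pow s) (Suc n) \<or> z + g \<in> bounding (X \<union> Pow s) (Suc n)"
    using bounding_add[OF b, of z'] bounding_add[OF b, of "z' + g"] by (auto simp: add.assoc)
qed

text \<open>The part of the filling outside \<open>X\<close> has its boundary in the intersection;
  acyclicity there replaces that part by a chain of \<open>X\<close>.\<close>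

lemma bounding_reflect:
  assumes X: "cpx X" and s: "s \<subseteq> V" and n: "n \<ge> 1" and ac: "acyclic_at (X \<inter> Pow s) n"
    and g: "g \<in> chains X n" "g \<in> bounding (X \<union> Pow s) n"
  shows "g \<in> bounding X n"
proof -
  obtain c where c: "c \<in> chains (X \<union> Pow s) (Suc n)" "bd c = g" using g unfolding bounding_def by blast
  let ?d = "c + restrict_chain X c"
  have "bd ?d \<in> chains (X \<inter> Pow s) n" by (rule interface_chain[OF X s c(1)]) (use c g in auto)
  then have "bd ?d \<in> bounding (X \<inter> Pow s) n" using ac unfolding acyclic_at_def by (metis bd_bd)
  then have "bd ?d \<in> bounding X n" using bounding_mono[of "X \<inter> Pow s" X] by blast
  moreover have "bd (restrict_chain X c) \<in> bounding X n"
    using restrict_chain_chains(1)[OF c(1)] unfolding bounding_def by blast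
  ultimately have "bd ?d + bd (restrict_chain X c) \<in> bounding X n" by (rule bounding_add)
  then show ?thesis using c(2) by (simp add: add.assoc)
qed

end

subsection \<open>Complexes built by gluing simplices\<close>

lemma induced_subset_iff: "F \<in> induced X W \<longleftrightarrow> F \<in> X \<and> F \<subseteq> W"
  by (simp add: induced_def)

lemma induced_eq_Int_Pow: "induced X W = X \<inter> Pow W"
  by (auto simp: induced_def)

text \<open>For \<open>hollow X \<tau>\<close> the induced subcomplex on \<open>\<tau>\<close> is the boundary \<open>\<partial>2\<^sup>\<tau>\<close>.\<close>

definition hollow :: "'a set set \<Rightarrow> 'a set \<Rightarrow> bool" where
  "hollow X \<tau> \<longleftrightarrow> \<tau> \<notin> X \<and> (\<forall>F. F \<subset> \<tau> \<longrightarrow> F \<in> X)"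

lemma hollow_induced: "hollow X \<tau> \<Longrightarrow> \<tau> \<subseteq> W \<Longrightarrow> hollow (induced X W) \<tau>"
  by (auto simp: hollow_def induced_def)

lemma hollow_vertices:
  assumes "hollow X \<tau>" "card \<tau> \<ge> 2"
  shows "\<tau> \<subseteq> \<Union>X"
proof
  fix x assume x: "x \<in> \<tau>"
  moreover have "{x} \<noteq> \<tau>" using assms(2) by auto
  ultimately have "{x} \<in> X" using assms(1) unfolding hollow_def by blast
  then show "x \<in> \<Union>X" by blast
qed

lemma is_simplex_induced: "is_simplex X \<Longrightarrow> is_simplex (induced X W)"
proof -
  assume "is_simplex X"
  then obtain U where "finite U" "X = Pow U" unfolding is_simplex_def by blast
  then have "finite (U \<inter> W)" "induced X W = Pow (U \<inter> W)" by (auto simp: induced_def)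
  then show ?thesis unfolding is_simplex_def by blast
qed

context finite_vertices
begin

inductive built :: "nat \<Rightarrow> 'a set set \<Rightarrow> bool" where
  simplex: "U \<subseteq> V \<Longrightarrow> built (Suc 0) (Pow U)"
| glue: "built k X \<Longrightarrow> s \<subseteq> V \<Longrightarrow> is_simplex (X \<inter> Pow s) \<Longrightarrow> built k (X \<union> Pow s)"
| weak_glue: "built k X \<Longrightarrow> s \<subseteq> V \<Longrightarrow> is_simplex (induced X (s - {u})) \<Longrightarrow>
    built (Suc k) (X \<union> Pow s)"

lemma built_cpx: "built k X \<Longrightarrow> cpx X"
  by (induction rule: built.induct) (simp_all add: cpx_Pow cpx_Un)

lemma built_pos: "built k X \<Longrightarrow> k \<ge> 1"
  by (induction rule: built.induct) simp_all

lemma built_induced: "built k X \<Longrightarrow> built k (induced X W)"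
proof (induction rule: built.induct)
  case (simplex U)
  have "induced (Pow U) W = Pow (U \<inter> W)" by (auto simp: induced_def)
  then show ?case using simplex built.simplex[of "U \<inter> W"] by auto
next
  case (glue k X s)
  have "induced X W \<inter> Pow (s \<inter> W) = induced (X \<inter> Pow s) W" by (auto simp: induced_def)
  then have "is_simplex (induced X W \<inter> Pow (s \<inter> W))" using glue is_simplex_induced by metis
  then have "built k (induced X W \<union> Pow (s \<inter> W))" using glue by (intro built.glue) auto
  moreover have "induced X W \<union> Pow (s \<inter> W) = induced (X \<union> Pow s) W" by (auto simp: induced_def)
  ultimately show ?case by simp
next
  case (weak_glue k X s u)
  have "induced (induced X W) (s \<inter> W - {u}) = induced (induced X (s - {u})) W"
    by (auto simp: induced_def)
  then have "is_simplex (induced (induced X W) (s \<inter> W - {u}))"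
    using weak_glue is_simplex_induced by metis
  then have "built (Suc k) (induced X W \<union> Pow (s \<inter> W))"
    using weak_glue by (intro built.weak_glue[of _ _ _ u]) auto
  moreover have "induced X W \<union> Pow (s \<inter> W) = induced (X \<union> Pow s) W" by (auto simp: induced_def)
  ultimately show ?case by simp
qed

lemma built_Int: "built k X \<Longrightarrow> built k (X \<inter> Pow s)"
  using built_induced[of k X s] by (simp add: induced_eq_Int_Pow)

text \<open>Induction on the index, then on the construction. In a weak step the hypothesis must
  cover every complex of index \<open>k\<close>, because it is applied to
  \<open>X \<inter> Pow s\<close>, which need not be a stage in the construction of
  \<open>X\<close>.\<close>

lemma built_strong_induct [consumes 1, case_names simplex glue weak_glue]:
  assumes "built k X"
    and "\<And>U. U \<subseteq> V \<Longrightarrow> P (Suc 0) (Pow U)"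
    and "\<And>k X s. built k X \<Longrightarrow> P k X \<Longrightarrow> s \<subseteq> V \<Longrightarrow> is_simplex (X \<inter> Pow s) \<Longrightarrow> P k (X \<union> Pow s)"
    and weak: "\<And>k X s u. built k X \<Longrightarrow> (\<And>Y. built k Y \<Longrightarrow> P k Y) \<Longrightarrow> s \<subseteq> V \<Longrightarrow>
      is_simplex (induced X (s - {u})) \<Longrightarrow> P (Suc k) (X \<union> Pow s)"
  shows "P k X"
  using assms(1)
proof (induction k arbitrary: X rule: less_induct)
  case (less k)
  have "built j X \<Longrightarrow> j = k \<Longrightarrow> P j X" for j X
  proof (induction rule: built.induct)
    case (weak_glue j X s u)
    then show ?case using less.IH[of j] weak[of j X s u] by simp
  qed (use assms in blast)+
  then show ?case using less.prems by blast
qed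

lemma simplex_intersection:
  assumes "cpx X" "is_simplex (X \<inter> Pow s)"
  obtains U where "U \<subseteq> V" "U \<subseteq> s" "X \<inter> Pow s = Pow U"
proof -
  obtain U where U: "X \<inter> Pow s = Pow U" using assms(2) unfolding is_simplex_def by blast
  then have "U \<in> X" "U \<subseteq> s" by auto
  show thesis by (rule that[OF cpx_vertices[OF assms(1) \<open>U \<in> X\<close>] \<open>U \<subseteq> s\<close> U])
qed

lemma acyclic_is_simplex:
  assumes "cpx X" "is_simplex (X \<inter> Pow s)" "n \<ge> 1"
  shows "acyclic_at (X \<inter> Pow s) n"
proof -
  obtain U where "U \<subseteq> V" "X \<inter> Pow s = Pow U" by (rule simplex_intersection[OF assms(1,2)])
  then show ?thesis using acyclic_simplex assms(3) by simp
qed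

text \<open>Degree \<open>n\<close> is dimension \<open>n - 1\<close>, so the bound says dimension
  at least \<open>k\<close>. A weak step raises the bound by one, which is exactly the shift of the
  connecting map into \<open>X \<inter> Pow s\<close>.\<close>

lemma built_acyclic: "built k X \<Longrightarrow> n \<ge> Suc k \<Longrightarrow> acyclic_at X n"
proof (induction arbitrary: n rule: built_strong_induct)
  case (simplex U)
  then show ?case using acyclic_simplex by simp
next
  case (glue k X s)
  note X = built_cpx[OF glue.hyps(1)]
  obtain n' where n': "n = Suc n'" "n' \<ge> k" using glue.prems Suc_le_D by auto
  have "n' \<ge> 1" using n' built_pos[OF glue.hyps(1)] by simp
  from acyclic_glue[OF X glue.hyps(2) _ acyclic_is_simplex[OF X glue.hyps(3) this]]
  show ?case using glue.IH glue.prems n'(1) by simp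
next
  case (weak_glue k X s u)
  obtain n' where n': "n = Suc n'" "n' \<ge> Suc k" using weak_glue.prems Suc_le_D by auto
  have "acyclic_at (X \<inter> Pow s) n'" by (rule weak_glue.IH[OF built_Int[OF weak_glue.hyps(1)] n'(2)])
  moreover have "acyclic_at X n" using weak_glue.IH[OF weak_glue.hyps(1)] weak_glue.prems by simp
  ultimately show ?case using n' acyclic_glue[OF built_cpx[OF weak_glue.hyps(1)] weak_glue.hyps(2)] by simp
qed

section \<open>Boundaries of single simplices\<close>

lemma bd_face_chain:
  assumes "\<tau> \<subseteq> V"
  shows "bd (face_chain \<tau>) = (\<lambda>F. if \<exists>v\<in>\<tau>. F = \<tau> - {v} then 1 else 0)"
proof
  fix F
  show "bd (face_chain \<tau>) F = (if \<exists>v\<in>\<tau>. F = \<tau> - {v} then 1 else 0)"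
  proof (cases "\<exists>v\<in>\<tau>. F = \<tau> - {v}")
    case True
    then obtain v where v: "v \<in> \<tau>" "F = \<tau> - {v}" by blast
    have "bd (face_chain \<tau>) F = (\<Sum>x\<in>V - F. if x = v then 1 else 0)"
      unfolding bd_def face_chain_def
    proof (rule sum.cong[OF refl])
      fix x assume x: "x \<in> V - F"
      have "insert x F = \<tau> \<longleftrightarrow> x = v"
      proof
        assume "insert x F = \<tau>"
        then have "x \<in> \<tau>" by (rule subst) simp
        then show "x = v" using x v(2) by simp
      qed (simp add: v insert_absorb)
      then show "(if insert x F = \<tau> then 1 else 0) = (if x = v then 1 else (0::bit))" by simp
    qed
    also have "\<dots> = 1" using v assms finite_V by (subst sum.delta) auto
    finally show ?thesis using True by simp
  next
    case False
    then have "insert x F \<noteq> \<tau>" if "x \<in> V - F" for x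
      using that by (metis DiffD2 Diff_insert_absorb insertI1)
    then have "bd (face_chain \<tau>) F = 0"
      unfolding bd_def face_chain_def by (intro sum.neutral) auto
    then show ?thesis using False by simp
  qed
qed

lemma bd_face_chain_Diff: "\<tau> \<subseteq> V \<Longrightarrow> v \<in> \<tau> \<Longrightarrow> bd (face_chain \<tau>) (\<tau> - {v}) = 1"
  by (auto simp: bd_face_chain)

lemma bd_face_chain_neq_0:
  "\<tau> \<subseteq> V \<Longrightarrow> bd (face_chain \<tau>) F \<noteq> 0 \<Longrightarrow> \<exists>v\<in>\<tau>. F = \<tau> - {v}"
  by (auto simp: bd_face_chain split: if_splits)

lemma hollow_subset_V: "cpx X \<Longrightarrow> hollow X \<tau> \<Longrightarrow> card \<tau> \<ge> 2 \<Longrightarrow> \<tau> \<subseteq> V"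
  using hollow_vertices[of X \<tau>] cpx_vertices[of X] by blast

lemma bd_face_chain_hollow:
  assumes "\<tau> \<subseteq> V" "hollow X \<tau>" "card \<tau> = Suc n"
  shows "bd (face_chain \<tau>) \<in> chains X n"
proof (rule chainsI)
  fix F assume "bd (face_chain \<tau>) F \<noteq> 0"
  then obtain v where v: "v \<in> \<tau>" "F = \<tau> - {v}" using bd_face_chain_neq_0 assms(1) by blast
  then have "F \<subset> \<tau>" by blast
  then show "F \<in> X \<and> card F = n" using v assms unfolding hollow_def by simp
qed

text \<open>Inside \<mu> the face \<open>\<mu> - {a, b}\<close> lies in just two faces with one
  vertex more, so their coefficients must agree. Hence a cycle is constant on the facets of
  \<partial>2^\<mu>.\<close>

lemma cycle_of_codim_one_faces:
  assumes mu: "\<mu> \<subseteq> V" and d: "\<And>F. d F \<noteq> 0 \<Longrightarrow> F \<subseteq> \<mu>" "bd d = 0"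
    and ab: "a \<in> \<mu>" "b \<in> \<mu>" "a \<noteq> b"
  shows "d (\<mu> - {a}) = d (\<mu> - {b})"
proof -
  let ?G = "\<mu> - {a, b}"
  have "bd d ?G = (\<Sum>v\<in>{a, b}. d (insert v ?G))"
    unfolding bd_def
  proof (rule sum.mono_neutral_right)
    show "\<forall>v\<in>V - ?G - {a, b}. d (insert v ?G) = 0" using d(1) by blast
  qed (use finite_V mu ab in auto)
  also have "\<dots> = d (insert a ?G) + d (insert b ?G)" using ab by simp
  also have "insert a ?G = \<mu> - {b}" using ab by auto
  also have "insert b ?G = \<mu> - {a}" using ab by auto
  finally show ?thesis using d(2) by (simp add: fun_eq_iff)
qed

text \<open>If all vertices of a subset of \<open>s\<close> are vertices of \<open>X\<close>, they
  lie in the simplex \<open>X \<inter> Pow s\<close>, and so does the subset. New faces therefore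
  need a new vertex.\<close>

lemma induced_glue_simplex:
  assumes X: "cpx X" and sx: "is_simplex (X \<inter> Pow s)" and W: "W \<subseteq> \<Union>X"
  shows "induced (X \<union> Pow s) W = induced X W"
proof -
  obtain U where U: "X \<inter> Pow s = Pow U" using sx unfolding is_simplex_def by blast
  have "F \<in> X" if F: "F \<subseteq> s" "F \<subseteq> W" for F
  proof -
    have "F \<subseteq> U"
    proof
      fix x assume x: "x \<in> F"
      then obtain G where "G \<in> X" "x \<in> G" using F W by blast
      then have "{x} \<in> X" using cpx_down[OF X, of G "{x}"] by blast
      then have "{x} \<in> Pow U" using x F U by blast
      then show "x \<in> U" by simp
    qed
    then show ?thesis using U by blast
  qed
  then show ?thesis by (auto simp: induced_def)
qed

text \<open>Away from \<open>u\<close> the complex is a simplex, so the missing edge \<tau> has the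
  form \<open>{u, b}\<close>. A filling contains an edge from \<open>u\<close> to some
  \<open>v\<close>, and \<open>v\<close> and \<open>b\<close> both lie in the simplex.\<close>

lemma cone_vertex_graph:
  assumes X: "cpx X" and sx: "is_simplex (induced X (V - {u}))"
    and h: "hollow X \<tau>" "card \<tau> = 2" and b: "bd (face_chain \<tau>) \<in> bounding X 1"
  shows "\<exists>v. \<forall>F. F \<subset> \<tau> \<longrightarrow> insert v F \<in> X"
proof -
  obtain U where U: "induced X (V - {u}) = Pow U" using sx unfolding is_simplex_def by blast
  have tV: "\<tau> \<subseteq> V" using hollow_subset_V[OF X h(1)] h(2) by simp
  have vU: "x \<in> U" if "{x} \<in> X" "x \<noteq> u" for x
  proof -
    have "{x} \<in> induced X (V - {u})" using that cpx_vertices[OF X] by (auto simp: induced_def)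
    then show ?thesis using U by simp
  qed
  have single: "{x} \<in> X" if "x \<in> \<tau>" for x
  proof -
    have "{x} \<noteq> \<tau>" using h(2) by auto
    then show ?thesis using that h(1) unfolding hollow_def by blast
  qed
  have "u \<in> \<tau>"
  proof (rule ccontr)
    assume "u \<notin> \<tau>"
    then have "\<tau> \<subseteq> U" using vU single by blast
    then have "\<tau> \<in> induced X (V - {u})" using U by simp
    then show False using h(1) by (simp add: hollow_def induced_def)
  qed
  moreover obtain x y where "\<tau> = {x, y}" "x \<noteq> y" using h(2) card_2_iff by meson
  ultimately obtain b where b': "\<tau> = {u, b}" "b \<noteq> u" by (cases "u = x") (auto simp: insert_commute)
  obtain c where c: "c \<in> chains X 2" "bd c = bd (face_chain \<tau>)"
    using b unfolding bounding_def by (auto simp: numeral_2_eq_2)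
  have "\<tau> - {b} = {u}" using b' by auto
  then have "bd c {u} \<noteq> 0" using c(2) bd_face_chain_Diff[OF tV, of b] b'(1) by simp
  then obtain v where v: "v \<in> V - {u}" "c (insert v {u}) \<noteq> 0"
    unfolding bd_def by (meson sum.not_neutral_contains_not_neutral)
  then have vu: "{v, u} \<in> X" using chainsD[OF c(1)] by simp
  then have "{v} \<in> X" using cpx_down[OF X] by blast
  then have "v \<in> U" "b \<in> U" using vU[of v] vU[of b] single[of b] v(1) b' by simp_all
  then have "{v, b} \<in> induced X (V - {u})" using U by simp
  then have "{v, b} \<in> X" by (simp add: induced_def)
  moreover have "F = {} \<or> F = {u} \<or> F = {b}" if "F \<subset> \<tau>" for F
    using that b' by (cases "u \<in> F"; cases "b \<in> F") auto
  ultimately have "insert v F \<in> X" if "F \<subset> \<tau>" for F using that vu \<open>{v} \<in> X\<close> by metis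
  then show ?thesis by blast
qed


subsection \<open>Cone vertices over hollow simplices\<close>

text \<open>If \<open>X\<close> contained all proper faces of \<tau>, then \<partial>2^\<tau> would
  bound in \<open>induced X \<tau>\<close>, where the only set large enough for a filling is the
  nonface \<tau>. So some facet of \<tau> is missing; being new, it lies in \<open>s\<close>, and
  the vertex it omits does not, since \<tau> is not in \<open>Pow s\<close>.\<close>

lemma missing_facet:
  assumes bX: "built k X" and h: "hollow (X \<union> Pow s) \<tau>" "card \<tau> = Suc (Suc k)"
  obtains t where "t \<in> \<tau>" "t \<notin> s" "\<tau> - {t} \<subseteq> s" "\<tau> - {t} \<notin> X"
proof -
  have "\<not> hollow X \<tau>"
  proof
    assume hX: "hollow X \<tau>"
    have tV: "\<tau> \<subseteq> V" using hollow_subset_V[OF built_cpx[OF bX] hX] h(2) by simp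
    have "bd (face_chain \<tau>) \<in> chains (induced X \<tau>) (Suc k)"
      using bd_face_chain_hollow[OF tV hollow_induced[OF hX] h(2)] by simp
    then have "bd (face_chain \<tau>) \<in> bounding (induced X \<tau>) (Suc k)"
      using built_acyclic[OF built_induced[OF bX, of \<tau>], of "Suc k"] unfolding acyclic_at_def by simp
    then obtain c where c: "c \<in> chains (induced X \<tau>) (Suc (Suc k))" "bd c = bd (face_chain \<tau>)"
      unfolding bounding_def by force
    have "c F = 0" for F
    proof (rule ccontr)
      assume "c F \<noteq> 0"
      then have F: "F \<in> X" "F \<subseteq> \<tau>" "card F = card \<tau>" using c(1) h(2) by (auto simp: chains_def induced_def)
      moreover have "finite \<tau>" using tV finite_V finite_subset by blast
      ultimately have "F = \<tau>" using card_subset_eq by blast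
      then show False using F(1) hX by (simp add: hollow_def)
    qed
    then have "c = 0" by (simp add: fun_eq_iff)
    then have "bd (face_chain \<tau>) = 0" using c(2) by simp
    moreover obtain x where "x \<in> \<tau>" using h(2) by fastforce
    ultimately show False using bd_face_chain_Diff[OF tV, of x] by simp
  qed
  moreover have "\<tau> \<notin> X" using h(1) by (simp add: hollow_def)
  ultimately obtain F where F: "F \<subset> \<tau>" "F \<notin> X" unfolding hollow_def by blast
  then obtain t where t: "t \<in> \<tau>" "t \<notin> F" by blast
  then have "F \<subseteq> \<tau> - {t}" using F(1) by blast
  then have n: "\<tau> - {t} \<notin> X" using F(2) cpx_down[OF built_cpx[OF bX]] by blast
  have "\<tau> - {t} \<subset> \<tau>" using t(1) by blast
  then have s: "\<tau> - {t} \<subseteq> s" using n h(1) unfolding hollow_def by blast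
  have "\<not> \<tau> \<subseteq> s" using h(1) unfolding hollow_def by blast
  then have "t \<notin> s" using s by blast
  from that[OF t(1) this s n] show thesis .
qed

text \<open>Every facet of \<tau> other than \<open>\<tau> - {t}\<close> contains \<open>t\<close>
  and lies in \<open>X\<close>. Hence the boundary of the part of the filling outside
  \<open>X\<close> differs from \<open>\<tau> - {t}\<close> by a chain of \<open>X\<close>, and this
  difference fills the boundary of \<open>\<tau> - {t}\<close> in the intersection.\<close>

lemma bounding_interface:
  assumes X: "cpx X" and s: "s \<subseteq> V" and tV: "\<tau> \<subseteq> V"
    and t: "t \<in> \<tau>" "\<tau> - {t} \<subseteq> s" and card: "card \<tau> = Suc (Suc k)"
    and faces: "\<And>F. F \<subset> \<tau> \<Longrightarrow> t \<in> F \<Longrightarrow> F \<in> X"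
    and b: "bd (face_chain \<tau>) \<in> bounding (X \<union> Pow s) (Suc k)"
  shows "bd (face_chain (\<tau> - {t})) \<in> bounding (X \<inter> Pow s) k"
proof -
  let ?\<rho> = "\<tau> - {t}"
  obtain c where c: "c \<in> chains (X \<union> Pow s) (Suc (Suc k))" "bd c = bd (face_chain \<tau>)"
    using b unfolding bounding_def by force
  let ?c = "restrict_chain X c"
  let ?w = "bd (c + ?c) + face_chain ?\<rho>"
  have "bd (c + ?c) \<in> chains (Pow s) (Suc k)"
    using bd_chains[OF cpx_Pow[OF s]] restrict_chain_chains(2)[OF c(1)] by blast
  moreover have "face_chain ?\<rho> \<in> chains (Pow s) (Suc k)"
    using t card by (intro face_chain_chains) auto
  ultimately have 1: "?w \<in> chains (Pow s) (Suc k)" by blast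
  have "bd (face_chain \<tau>) + face_chain ?\<rho> \<in> chains X (Suc k)"
  proof (rule chainsI)
    fix F assume F: "(bd (face_chain \<tau>) + face_chain ?\<rho>) F \<noteq> 0"
    have ne: "F \<noteq> ?\<rho>" using F bd_face_chain_Diff[OF tV t(1)] by auto
    then have "bd (face_chain \<tau>) F \<noteq> 0" using F by (simp add: face_chain_def)
    then obtain x where x: "x \<in> \<tau>" "F = \<tau> - {x}" using bd_face_chain_neq_0[OF tV] by blast
    then have "t \<in> F" "F \<subset> \<tau>" using ne t(1) by auto
    then show "F \<in> X \<and> card F = Suc k" using faces x card by simp
  qed
  moreover have "bd ?c \<in> chains X (Suc k)" using bd_chains[OF X] restrict_chain_chains(1)[OF c(1)] by blast
  ultimately have "(bd (face_chain \<tau>) + face_chain ?\<rho>) + bd ?c \<in> chains X (Suc k)" by blast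
  moreover have "(bd (face_chain \<tau>) + face_chain ?\<rho>) + bd ?c = ?w" using c(2) by (simp add: ac_simps)
  ultimately have "?w \<in> chains X (Suc k)" by simp
  then have "?w \<in> chains (X \<inter> Pow s) (Suc k)" using 1 by (auto simp: chains_def)
  moreover have "bd ?w = bd (face_chain ?\<rho>)" by simp
  ultimately show ?thesis unfolding bounding_def by (metis imageI)
qed

text \<open>With \<open>\<rho> = \<tau> - {t}\<close>, the suspension \<open>{t, v} * \<partial>2\<^sup>\<rho>\<close> is a sphere in the acyclic complex \<open>X[\<tau> \<union> {v}]\<close>.
  On this vertex set it has only two fillings, and the one made of \<open>\<tau>\<close> and \<open>\<rho> \<union> {v}\<close> is not
  available because \<open>\<rho>\<close> is not a face.\<close>

lemma suspension_faces:
  assumes bX: "built k X" and tV: "insert v \<tau> \<subseteq> V" and t: "t \<in> \<tau>" "v \<notin> \<tau>"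
    and card: "card \<tau> = Suc (Suc k)"
    and n: "\<tau> - {t} \<notin> X"
    and faces: "\<And>F. F \<subset> \<tau> \<Longrightarrow> t \<in> F \<Longrightarrow> F \<in> X" "\<And>F. F \<subset> \<tau> - {t} \<Longrightarrow> insert v F \<in> X"
    and r: "r \<in> \<tau> - {t}"
  shows "insert v \<tau> - {r} \<in> X"
proof -
  let ?\<mu> = "insert v \<tau>" and ?\<rho> = "\<tau> - {t}" and ?\<upsilon> = "insert v (\<tau> - {t})"
  let ?Y = "induced X ?\<mu>"
  let ?z = "bd (face_chain \<tau> + face_chain ?\<upsilon>)"
  have \<tau>V: "\<tau> \<subseteq> V" and \<upsilon>V: "?\<upsilon> \<subseteq> V" using tV by auto
  have fin: "finite \<tau>" using \<tau>V finite_V finite_subset by blast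
  have \<upsilon>: "?\<upsilon> - {v} = ?\<rho>" "card ?\<upsilon> = Suc (Suc k)" using t card fin by auto
  have notX: "\<tau> \<notin> X" "?\<upsilon> \<notin> X"
    using n cpx_down[OF built_cpx[OF bX], of _ ?\<rho>] by blast+
  have "?z \<in> chains ?Y (Suc k)"
  proof (rule chainsI)
    fix F assume F: "?z F \<noteq> 0"
    \<comment> \<open>The common facet \<rho> of \<tau> and \<upsilon> cancels, which leaves the
      suspension.\<close>
    have "?z ?\<rho> = 0"
      using bd_face_chain_Diff[OF \<tau>V t(1)] bd_face_chain_Diff[OF \<upsilon>V insertI1] unfolding \<upsilon>(1) by simp
    then have ne: "F \<noteq> ?\<rho>" using F by metis
    have "bd (face_chain \<tau>) F \<noteq> 0 \<or> bd (face_chain ?\<upsilon>) F \<noteq> 0" using F by auto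
    then have "(\<exists>x\<in>\<tau>. F = \<tau> - {x}) \<or> (\<exists>x\<in>?\<upsilon>. F = ?\<upsilon> - {x})"
      using bd_face_chain_neq_0[OF \<tau>V] bd_face_chain_neq_0[OF \<upsilon>V] by blast
    then consider x where "x \<in> \<tau>" "x \<noteq> t" "F = \<tau> - {x}"
      | x where "x \<in> ?\<upsilon>" "x \<noteq> v" "F = ?\<upsilon> - {x}"
    proof (elim disjE bexE)
      fix x assume x: "x \<in> \<tau>" "F = \<tau> - {x}"
      then have "x \<noteq> t" using ne by blast
      with x show thesis by (rule_tac that(1))
    next
      fix x assume x: "x \<in> ?\<upsilon>" "F = ?\<upsilon> - {x}"
      then have "x \<noteq> v" using ne \<upsilon>(1) by metis
      with x show thesis by (rule_tac that(2))
    qed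
    then show "F \<in> ?Y \<and> card F = Suc k"
    proof cases
      case 1
      then have "F \<in> X" using t(1) by (intro faces) auto
      then show ?thesis using 1 card by (auto simp: induced_def)
    next
      case 2
      have "F = insert v (?\<rho> - {x})" unfolding 2(3) using 2(2) by (simp add: insert_Diff_if)
      moreover have "?\<rho> - {x} \<subset> ?\<rho>" using 2(1,2) by blast
      ultimately have "F \<in> X" using faces(2) by simp
      moreover have "card F = Suc k" unfolding 2(3) using 2(1) \<upsilon>(2) by (metis card_Diff_singleton diff_Suc_1)
      moreover have "F \<subseteq> ?\<mu>" using 2 by auto
      ultimately show ?thesis by (simp add: induced_def)
    qed
  qed
  moreover have "acyclic_at ?Y (Suc k)" by (rule built_acyclic[OF built_induced[OF bX] order_refl])
  ultimately have "?z \<in> bounding ?Y (Suc k)" unfolding acyclic_at_def by simp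
  then obtain c where c: "c \<in> chains ?Y (Suc (Suc k))" "bd c = ?z" unfolding bounding_def by force
  let ?d = "c + (face_chain \<tau> + face_chain ?\<upsilon>)"
  have cX: "c F \<noteq> 0 \<Longrightarrow> F \<in> X \<and> F \<subseteq> ?\<mu>" for F using chainsD[OF c(1)] by (auto simp: induced_def)
  have "?d (?\<mu> - {r}) = ?d (?\<mu> - {v})"
  proof (rule cycle_of_codim_one_faces[OF tV])
    show "bd ?d = 0" using c(2) by simp
    show "F \<subseteq> ?\<mu>" if "?d F \<noteq> 0" for F
    proof (cases "c F = 0")
      case True
      then have "F = \<tau> \<or> F = ?\<upsilon>" using that by (auto simp: face_chain_def split: if_splits)
      then show ?thesis by blast
    qed (use cX in blast)
  qed (use r t in auto)
  also have "?\<mu> - {v} = \<tau>" using t by auto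
  also have "?d \<tau> = 1"
  proof -
    have "c \<tau> = 0" using cX notX(1) by blast
    moreover have "\<tau> \<noteq> ?\<upsilon>" using t by auto
    ultimately show ?thesis by (simp add: face_chain_def)
  qed
  finally have d: "?d (?\<mu> - {r}) = 1" .
  have "?\<mu> - {r} \<noteq> \<tau>" using r by auto
  moreover have "?\<mu> - {r} \<noteq> ?\<upsilon>" using r by auto
  ultimately have "c (?\<mu> - {r}) = 1" using d by (simp add: face_chain_def)
  then show ?thesis using cX[of "?\<mu> - {r}"] by simp
qed

text \<open>In the step, exactly one facet \<open>\<rho> = \<tau> - {t}\<close> of \<open>\<partial>2\<^sup>\<tau>\<close> is new; its boundary bounds in \<open>K = X \<inter> 2\<^sup>s\<close>,
  which has index one lower, and a cone vertex for \<open>\<rho>\<close> in \<open>K\<close> is one for \<open>\<tau>\<close>.\<close>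

lemma cone_vertex:
  assumes "built k X" "hollow X \<tau>" "card \<tau> = Suc k" "bd (face_chain \<tau>) \<in> bounding X k" "k \<ge> 2"
  shows "\<exists>v. \<forall>F. F \<subset> \<tau> \<longrightarrow> insert v F \<in> X"
  using assms
proof (induction arbitrary: \<tau> rule: built_strong_induct)
  case (simplex U)
  then show ?case by simp
next
  case (glue k X s)
  note X = built_cpx[OF glue.hyps(1)]
  have tn: "\<tau> \<notin> X" "\<not> \<tau> \<subseteq> s" using glue.prems(1) unfolding hollow_def by auto
  \<comment> \<open>A vertex \<open>t\<close> of \<tau> new to \<open>X\<close> would force every
    \<open>{t, x}\<close> with \<open>x\<close> in \<tau> into \<open>s\<close>, hence \<tau>
    itself. These sets are proper faces because \<open>k \<ge> 2\<close>.\<close>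
  have tX: "\<tau> \<subseteq> \<Union>X"
  proof (rule ccontr)
    assume "\<not> \<tau> \<subseteq> \<Union>X"
    then obtain t where t: "t \<in> \<tau>" "t \<notin> \<Union>X" by blast
    have "x \<in> s" if x: "x \<in> \<tau>" for x
    proof -
      have "card {t, x} < card \<tau>" using glue.prems(2,4) card_insert_le_m1[of 2 "{x}" t] by simp
      then have "{t, x} \<noteq> \<tau>" by blast
      then have "{t, x} \<subset> \<tau>" using t x by blast
      then have "{t, x} \<in> X \<union> Pow s" using glue.prems(1) unfolding hollow_def by blast
      then show ?thesis using t(2) by blast
    qed
    then show False using tn(2) by blast
  qed
  have "induced (X \<union> Pow s) \<tau> = induced X \<tau>" by (rule induced_glue_simplex[OF X glue.hyps(3) tX])
  then have "F \<in> X" if "F \<subset> \<tau>" for F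
    using that glue.prems(1) unfolding hollow_def induced_def by blast
  then have h: "hollow X \<tau>" using tn(1) unfolding hollow_def by blast
  have tV: "\<tau> \<subseteq> V" using hollow_subset_V[OF X h] glue.prems by simp
  have k: "k \<ge> 1" using glue.prems by simp
  have "bd (face_chain \<tau>) \<in> bounding X k"
    by (rule bounding_reflect[OF X glue.hyps(2) k acyclic_is_simplex[OF X glue.hyps(3) k]
        bd_face_chain_hollow[OF tV h glue.prems(2)] glue.prems(3)])
  from glue.IH[OF h glue.prems(2) this glue.prems(4)] show ?case by blast
next
  case (weak_glue k X s u)
  note X = built_cpx[OF weak_glue.hyps(1)]
  note h = weak_glue.prems(1)
  have card: "card \<tau> = Suc (Suc k)" using weak_glue.prems by simp
  obtain t where t: "t \<in> \<tau>" "t \<notin> s" "\<tau> - {t} \<subseteq> s" "\<tau> - {t} \<notin> X"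
    using missing_facet[OF weak_glue.hyps(1) h card] .
  let ?\<rho> = "\<tau> - {t}" and ?K = "X \<inter> Pow s"
  have faces: "F \<in> X" if "F \<subset> \<tau>" "t \<in> F" for F using that h t(2) unfolding hollow_def by blast
  have bK: "built k ?K" by (rule built_Int[OF weak_glue.hyps(1)])
  have tV: "\<tau> \<subseteq> V"
    using hollow_subset_V[OF cpx_Un[OF X cpx_Pow[OF weak_glue.hyps(2)]] h] card by simp
  have fin: "finite \<tau>" using tV finite_V finite_subset by blast
  have c\<rho>: "card ?\<rho> = Suc k" using card t(1) by simp
  have hK: "hollow ?K ?\<rho>"
    unfolding hollow_def
  proof (intro conjI allI impI)
    fix F assume F: "F \<subset> ?\<rho>"
    then have "insert t F \<subset> \<tau>" using t(1) by blast
    then have "F \<in> X" using faces[of "insert t F"] cpx_down[OF X, of "insert t F" F] by blast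
    then show "F \<in> ?K" using F t(3) by blast
  qed (use t(4) in blast)
  have b: "bd (face_chain ?\<rho>) \<in> bounding ?K k"
    by (rule bounding_interface[OF X weak_glue.hyps(2) tV t(1,3) card faces weak_glue.prems(3)])
  \<comment> \<open>The induction hypothesis starts at index 2. For \<open>k = 1\<close> the weak
    condition enters instead: deleting \<open>u\<close> from the interface leaves a simplex.\<close>
  have "\<exists>v. \<forall>F. F \<subset> ?\<rho> \<longrightarrow> insert v F \<in> ?K"
  proof (cases "k \<ge> 2")
    case True
    then show ?thesis using weak_glue.IH[OF bK hK c\<rho> b] by blast
  next
    case False
    then have k: "k = 1" using weak_glue.prems(4) by simp
    have "induced ?K (V - {u}) = induced X (s - {u})"
      using weak_glue.hyps(2) by (auto simp: induced_def)
    then have "is_simplex (induced ?K (V - {u}))" using weak_glue.hyps(3) by simp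
    from cone_vertex_graph[OF built_cpx[OF bK] this hK] show ?thesis using c\<rho> b k by simp
  qed
  then obtain v where v: "\<And>F. F \<subset> ?\<rho> \<Longrightarrow> insert v F \<in> ?K" by blast
  have "?\<rho> \<noteq> {}" using c\<rho> by (metis card.empty nat.distinct(1))
  then have "insert v {} \<in> ?K" by (intro v) blast
  then have vs: "v \<in> s" "v \<in> V" using weak_glue.hyps(2) by auto
  have "v \<notin> ?\<rho>"
  proof
    assume "v \<in> ?\<rho>"
    then have "insert v (?\<rho> - {v}) \<in> ?K" by (intro v) blast
    then show False using \<open>v \<in> ?\<rho>\<close> t(4) by (simp add: insert_absorb)
  qed
  moreover have "v \<noteq> t" using vs t by blast
  ultimately have vt: "v \<notin> \<tau>" by simp
  have susp: "insert v \<tau> - {r} \<in> X" if "r \<in> ?\<rho>" for r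
    by (rule suspension_faces[OF weak_glue.hyps(1) _ t(1) vt card t(4) faces _ that])
      (use tV vs v in auto)
  \<comment> \<open>Without \<open>t\<close>, both \<open>F\<close> and \<open>v\<close> lie in
    \<open>s\<close>. With \<open>t\<close>, the face \<open>F\<close> misses some \<open>r\<close>
    of \<rho>, and the suspension face omitting \<open>r\<close> contains \<open>F\<close> and
    \<open>v\<close>.\<close>
  have "insert v F \<in> X \<union> Pow s" if F: "F \<subset> \<tau>" for F
  proof (cases "t \<in> F")
    case False
    then have "F \<subseteq> s" using F t(3) by blast
    then show ?thesis using vs by blast
  next
    case True
    then obtain r where r: "r \<in> ?\<rho>" "r \<notin> F" using F by blast
    moreover have "r \<noteq> v" using r vt by blast
    ultimately have "insert v F \<subseteq> insert v \<tau> - {r}" using F by blast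
    then show ?thesis using susp[OF r(1)] cpx_down[OF X] by blast
  qed
  then show ?case by blast
qed

end

subsection \<open>Induced cycles from shortest paths\<close>

lemma induced_hollow: "hollow X \<tau> \<Longrightarrow> induced X \<tau> = Pow \<tau> - {\<tau>}"
  unfolding hollow_def induced_def by auto

lemma facets_simplex_boundary: "facets (Pow \<tau> - {\<tau>}) = {\<tau> - {x} | x. x \<in> \<tau>}"
proof (intro equalityI subsetI)
  fix F assume F: "F \<in> facets (Pow \<tau> - {\<tau>})"
  then obtain x where x: "x \<in> \<tau>" "x \<notin> F" "F \<subseteq> \<tau>" unfolding facets_def by blast
  then have "\<tau> - {x} \<in> Pow \<tau> - {\<tau>}" "F \<subseteq> \<tau> - {x}" by blast+
  then have "F = \<tau> - {x}" using F unfolding facets_def by blast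
  then show "F \<in> {\<tau> - {x} | x. x \<in> \<tau>}" using x by blast
next
  fix F assume "F \<in> {\<tau> - {x} | x. x \<in> \<tau>}"
  then obtain x where x: "x \<in> \<tau>" "F = \<tau> - {x}" by blast
  have "F = G" if G: "G \<in> Pow \<tau> - {\<tau>}" "F \<subseteq> G" for G
  proof -
    have "x \<notin> G" using G x by blast
    then show ?thesis using G x by blast
  qed
  moreover have "F \<in> Pow \<tau> - {\<tau>}" using x by blast
  ultimately show "F \<in> facets (Pow \<tau> - {\<tau>})" unfolding facets_def by blast
qed

lemma consecutive_pairs_only:
  fixes f :: "nat \<Rightarrow> 'b"
  assumes "inj_on f {..n}" "F \<subseteq> f ` {..n}"
    and step: "\<And>i j. i < j \<Longrightarrow> j \<le> n \<Longrightarrow> f i \<in> F \<Longrightarrow> f j \<in> F \<Longrightarrow> j = Suc i"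
  shows "F = {} \<or> (\<exists>i\<le>n. F = {f i}) \<or> (\<exists>i<n. F = {f i, f (Suc i)})"
proof (cases "F = {}")
  case False
  then obtain i0 where "i0 \<le> n" "f i0 \<in> F" using assms(2) by blast
  define i where "i = (LEAST i. i \<le> n \<and> f i \<in> F)"
  have i: "i \<le> n" "f i \<in> F"
    using LeastI[of "\<lambda>i. i \<le> n \<and> f i \<in> F" i0] \<open>i0 \<le> n\<close> \<open>f i0 \<in> F\<close> unfolding i_def by blast+
  have least: "i \<le> j" if "j \<le> n" "f j \<in> F" for j
    unfolding i_def by (rule Least_le) (use that in blast)
  have sub: "F \<subseteq> {f i, f (Suc i)}"
  proof
    fix x assume "x \<in> F"
    then obtain j where j: "j \<le> n" "x = f j" "f j \<in> F" using assms(2) by blast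
    then have "j = i \<or> j = Suc i" using least[of j] step[of i j] i by fastforce
    then show "x \<in> {f i, f (Suc i)}" using j by blast
  qed
  show ?thesis
  proof (cases "f (Suc i) \<in> F \<and> i < n")
    case True
    then have "F = {f i, f (Suc i)}" using sub i by blast
    then show ?thesis using True by blast
  next
    case False
    have "F \<subseteq> {f i}"
    proof
      fix x assume "x \<in> F"
      then obtain j where j: "j \<le> n" "x = f j" "f j \<in> F" using assms(2) by blast
      then have "j = i \<or> j = Suc i" using least[of j] step[of i j] i by fastforce
      then show "x \<in> {f i}" using j False by auto
    qed
    then have "F = {f i}" using i by blast
    then show ?thesis using i by blast
  qed
qed simp

text \<open>The vertices are \<open>f 0\<close> to \<open>f n\<close>, so for injective
  \<open>f\<close> and \<open>n \<ge> 2\<close> the cycle has length \<open>n + 1\<close>; the last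
  edge closes the path.\<close>

definition polygon :: "(nat \<Rightarrow> 'a) \<Rightarrow> nat \<Rightarrow> 'a set set" where
  "polygon f n = {{}} \<union> {{f i} | i. i \<le> n} \<union> {{f i, f (Suc i)} | i. i < n} \<union> {{f 0, f n}}"

lemma is_cycle_polygon:
  assumes inj: "inj_on f {..n}" and n: "n \<ge> 2"
  shows "is_cycle_complex (polygon f n)"
proof -
  let ?vs = "map f [0..<Suc n]"
  have len: "length ?vs = Suc n" by simp
  have nth: "?vs ! i = f i" if "i \<le> n" for i using that by (simp del: upt_Suc)
  have "{{?vs ! i, ?vs ! ((i + 1) mod length ?vs)} | i. i < length ?vs}
      = {{f i, f (Suc i)} | i. i < n} \<union> {{f 0, f n}}" (is "?A = ?B")
  proof (intro equalityI subsetI)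
    fix e assume "e \<in> ?A"
    then obtain i where i: "i < Suc n" "e = {?vs ! i, ?vs ! ((i + 1) mod Suc n)}" unfolding len by blast
    show "e \<in> ?B"
    proof (cases "i = n")
      case True
      then have "e = {f n, f 0}" using i nth by simp
      then show ?thesis by (simp add: insert_commute)
    next
      case False
      then have "e = {f i, f (Suc i)}" "i < n" using i nth by simp_all
      then show ?thesis by blast
    qed
  next
    fix e assume "e \<in> ?B"
    then consider i where "i < n" "e = {f i, f (Suc i)}" | "e = {f 0, f n}" by blast
    then show "e \<in> ?A"
    proof cases
      case 1
      then have "e = {?vs ! i, ?vs ! ((i + 1) mod Suc n)}" "i < Suc n" using nth by simp_all
      then show ?thesis unfolding len by blast
    next
      case 2
      then have "e = {?vs ! n, ?vs ! ((n + 1) mod Suc n)}" using nth by (simp add: insert_commute)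
      then show ?thesis unfolding len by blast
    qed
  qed
  moreover have "{{v} | v. v \<in> set ?vs} = {{f i} | i. i \<le> n}" by (auto simp del: upt_Suc)
  ultimately have "polygon f n = {{}} \<union> {{v} | v. v \<in> set ?vs} \<union>
         {{?vs ! i, ?vs ! ((i + 1) mod length ?vs)} | i. i < length ?vs}"
    unfolding polygon_def by (simp only: Un_assoc)
  moreover have "distinct ?vs"
    using inj by (simp add: distinct_map atLeast0LessThan lessThan_Suc_atMost del: upt_Suc)
  moreover have "length ?vs \<ge> 3" using n by simp
  ultimately show ?thesis unfolding is_cycle_complex_def by blast
qed

lemma facets_polygon:
  assumes inj: "inj_on f {..n}" and n: "n \<ge> 2"
  shows "facets (polygon f n) = {{f i, f (Suc i)} | i. i < n} \<union> {{f 0, f n}}"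
proof -
  let ?E = "{{f i, f (Suc i)} | i. i < n} \<union> {{f 0, f n}}"
  have ne: "f i \<noteq> f j" if "i \<le> n" "j \<le> n" "i \<noteq> j" for i j using inj that by (auto dest: inj_onD)
  have c2: "card e = 2" if e: "e \<in> ?E" for e
  proof -
    consider i where "i < n" "e = {f i, f (Suc i)}" | "e = {f 0, f n}" using e by blast
    then show ?thesis using ne[of _ "Suc _"] ne[of 0 n] n by cases simp_all
  qed
  have split: "F \<in> ?E \<or> (\<exists>i\<le>n. F \<subseteq> {f i})" if "F \<in> polygon f n" for F
    using that unfolding polygon_def by blast
  have le: "card F \<le> 2 \<and> finite F" if F: "F \<in> polygon f n" for F
  proof (cases "F \<in> ?E")
    case True
    show ?thesis using c2[OF True] card.infinite[of F] by linarith
  next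
    case False
    then obtain i where "F \<subseteq> {f i}" using split[OF F] by blast
    then show ?thesis using card_mono[of "{f i}" F] finite_subset[of F "{f i}"] by simp
  qed
  have up: "\<exists>e\<in>?E. F \<subset> e" if F: "F \<in> polygon f n" "F \<notin> ?E" for F
  proof -
    obtain i where i: "i \<le> n" "F \<subseteq> {f i}" using split[OF F(1)] F(2) by blast
    obtain e where e: "e \<in> ?E" "f i \<in> e"
    proof (cases "i = n")
      case True
      show thesis by (rule that[of "{f 0, f n}"]) (use True in auto)
    next
      case False
      then have "i < n" using i(1) by simp
      show thesis by (rule that[of "{f i, f (Suc i)}"]) (use \<open>i < n\<close> in auto)
    qed
    have "F \<subseteq> e" using e(2) i(2) by blast
    then show ?thesis using e(1) F(2) by blast
  qed
  have "?E \<subseteq> polygon f n" unfolding polygon_def by blast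
  show ?thesis
  proof (intro equalityI subsetI)
    fix F assume F: "F \<in> facets (polygon f n)"
    then have "F \<in> polygon f n" unfolding facets_def by blast
    then show "F \<in> ?E" using up[of F] F \<open>?E \<subseteq> polygon f n\<close> unfolding facets_def by blast
  next
    fix F assume F: "F \<in> ?E"
    have "F = G" if G: "G \<in> polygon f n" "F \<subseteq> G" for G
      using card_seteq[OF _ G(2)] le[OF G(1)] c2[OF F] by simp
    then show "F \<in> facets (polygon f n)" using F \<open>?E \<subseteq> polygon f n\<close> unfolding facets_def by blast
  qed
qed

context finite_vertices
begin

lemma facet_sum_hollow:
  assumes "hollow X \<tau>" "\<tau> \<subseteq> V"
  shows "facet_sum (induced X \<tau>) = bd (face_chain \<tau>)"
  unfolding induced_hollow[OF assms(1)] facet_sum_def facets_simplex_boundary bd_face_chain[OF assms(2)]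
  by (rule ext) (rule if_cong, auto)

lemma bd_face_chain_edge:
  assumes "a \<in> V" "b \<in> V" "a \<noteq> b"
  shows "bd (face_chain {a, b}) = face_chain {a} + face_chain {b}"
proof
  fix F
  have "{a, b} - {a} = {b}" "{a, b} - {b} = {a}" using assms by auto
  then have "(\<exists>v\<in>{a, b}. F = {a, b} - {v}) \<longleftrightarrow> F = {a} \<or> F = {b}" by auto
  moreover have "{a, b} \<subseteq> V" "{a} \<noteq> {b}" using assms by auto
  ultimately show "bd (face_chain {a, b}) F = (face_chain {a} + face_chain {b}) F"
    by (subst bd_face_chain) (auto simp: face_chain_def)
qed

lemma bd_face_chain_vertex_empty: "a \<in> V \<Longrightarrow> bd (face_chain {a}) {} = 1"
  using bd_face_chain_Diff[of "{a}" a] by simp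

fun path_chain :: "(nat \<Rightarrow> 'a) \<Rightarrow> nat \<Rightarrow> 'a set \<Rightarrow> bit" where
  "path_chain f 0 = 0"
| "path_chain f (Suc n) = path_chain f n + face_chain {f n, f (Suc n)}"

lemma bd_path_chain:
  assumes "inj_on f {..n}" "f ` {..n} \<subseteq> V"
  shows "bd (path_chain f n) = face_chain {f 0} + face_chain {f n}"
  using assms
proof (induction n)
  case (Suc n)
  have "inj_on f {..n}" "f ` {..n} \<subseteq> V" using Suc.prems by (auto intro: inj_on_subset)
  moreover have "f n \<noteq> f (Suc n)" using Suc.prems(1) by (auto dest: inj_onD)
  then have "bd (face_chain {f n, f (Suc n)}) = face_chain {f n} + face_chain {f (Suc n)}"
    using Suc.prems(2) by (intro bd_face_chain_edge) auto
  ultimately show ?case unfolding path_chain.simps bd_add by (simp only: Suc.IH add.assoc chain_add_self_left)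
qed simp

text \<open>Injectivity ensures that no edge is traversed twice, which would cancel it.\<close>

lemma path_chain_eq:
  assumes "inj_on f {..n}"
  shows "path_chain f n F = (if \<exists>i<n. F = {f i, f (Suc i)} then 1 else 0)"
  using assms
proof (induction n)
  case (Suc n)
  have inj: "inj_on f {..n}" by (rule inj_on_subset[OF Suc.prems]) simp
  have ne: "{f i, f (Suc i)} \<noteq> {f n, f (Suc n)}" if "i < n" for i
  proof -
    have "f (Suc n) \<noteq> f i" "f (Suc n) \<noteq> f (Suc i)"
      using that by (simp_all add: inj_on_eq_iff[OF Suc.prems])
    then have "f (Suc n) \<notin> {f i, f (Suc i)}" by simp
    then show ?thesis by (rule contrapos_nn) simp
  qed
  have disjoint: "(if Q then 1 else 0) + (if P then 1 else 0) = (if P \<or> Q then 1 else (0::bit))"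
    if "\<not> (Q \<and> P)" for P Q using that by simp
  have "\<not> ((\<exists>i<n. F = {f i, f (Suc i)}) \<and> F = {f n, f (Suc n)})"
  proof (intro notI, elim conjE exE)
    fix i assume "i < n" "F = {f i, f (Suc i)}" "F = {f n, f (Suc n)}"
    then show False using ne[of i] by simp
  qed
  from disjoint[OF this] show ?case
    unfolding path_chain.simps plus_fun_apply Suc.IH[OF inj] Ex_less_Suc face_chain_def .
qed simp

definition adjacent :: "'a set set \<Rightarrow> ('a \<times> 'a) set" where
  "adjacent X = {(a, b). a \<noteq> b \<and> {a, b} \<in> X}"

text \<open>Otherwise the part of a filling inside the component of \<open>u\<close> would have the single vertex \<open>u\<close> as
  its boundary, which is not a cycle in reduced homology.\<close>

lemma bounding_connected:
  assumes X: "cpx X" and uw: "u \<in> V" "w \<in> V" "u \<noteq> w"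
    and b: "face_chain {u} + face_chain {w} \<in> bounding X 1"
  shows "(u, w) \<in> (adjacent X)\<^sup>*"
proof (rule ccontr)
  assume nw: "\<not> ?thesis"
  define C where "C = {x. (u, x) \<in> (adjacent X)\<^sup>*}"
  obtain c where c: "c \<in> chains X (Suc 1)" "bd c = face_chain {u} + face_chain {w}"
    using b unfolding bounding_def by force
  let ?c = "restrict_chain (Pow C) c"
  have cC: "?c \<in> chains X (Suc 1)" using c(1) unfolding chains_def restrict_chain_def by auto
  have "bd ?c = face_chain {u}"
  proof
    fix F
    show "bd ?c F = face_chain {u} F"
    proof (cases "card F = 1")
      case False
      then have "bd ?c F = 0" using bd_chains[OF X cC] by (auto simp: chains_def)
      moreover have "F \<noteq> {u}" using False by auto
      ultimately show ?thesis by (simp add: face_chain_def)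
    next
      case True
      then obtain x where x: "F = {x}" using card_1_singletonE by blast
      show ?thesis
      proof (cases "x \<in> C")
        case True
        have "?c {v, x} = c {v, x}" if v: "v \<in> V - {x}" for v
        proof (cases "c {v, x} = 0")
          case True
          then show ?thesis by (simp add: restrict_chain_def)
        next
          case False
          then have "(x, v) \<in> adjacent X"
            using v chainsD[OF c(1)] unfolding adjacent_def by (auto simp: insert_commute)
          then have "v \<in> C" using True unfolding C_def by (simp add: rtrancl_into_rtrancl)
          then show ?thesis using True by (simp add: restrict_chain_def)
        qed
        then have "bd ?c F = bd c F" unfolding bd_def x by (intro sum.cong) auto
        moreover have "x \<noteq> w" using True nw unfolding C_def by blast
        ultimately show ?thesis using c(2) x by (simp add: face_chain_def)
      next
        case False
        have "bd ?c F = 0" unfolding bd_def x using False by (intro sum.neutral) (simp add: restrict_chain_def)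
        moreover have "u \<in> C" unfolding C_def by simp
        ultimately show ?thesis using x False by (auto simp: face_chain_def)
      qed
    qed
  qed
  then have "bd (face_chain {u}) = 0" by (metis bd_bd)
  then show False using bd_face_chain_vertex_empty[OF uw(1)] by (simp add: fun_eq_iff)
qed


subsection \<open>Generators of the top homology\<close>

text \<open>\<open>induced X W\<close> does not see elements of \<open>W\<close> that are not
  vertices; the first conjunct excludes them, and it also makes later attachments along simplices
  leave the hole unchanged. Index 2 stands apart because an induced cycle may have any
  length.\<close>

definition hole :: "nat \<Rightarrow> 'a set set \<Rightarrow> 'a set \<Rightarrow> bool" where
  "hole k X W \<longleftrightarrow> W \<subseteq> \<Union>X \<and>
     (if k = 2 then is_cycle_complex (induced X W) else hollow X W \<and> card W = Suc k)"

lemma vertex_face: "cpx X \<Longrightarrow> x \<in> \<Union>X \<Longrightarrow> {x} \<in> X"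
  using cpx_down[of X _ "{x}"] by blast

text \<open>A cycle that becomes a simplex after deleting one vertex is a triangle; this puts the case
  \<open>k = 2\<close> of the induction into the same form as the higher ones.\<close>

lemma cycle_in_cone:
  assumes K: "cpx K" and W: "W \<subseteq> \<Union>K" and cyc: "is_cycle_complex (induced K W)"
    and sx: "is_simplex (induced K (V - {u}))"
  shows "hollow K W \<and> card W = 3"
proof -
  obtain vs where vs: "distinct vs" "length vs \<ge> 3" and Y: "induced K W =
     {{}} \<union> {{v} | v. v \<in> set vs} \<union> {{vs ! i, vs ! ((i + 1) mod length vs)} | i. i < length vs}"
    using cyc unfolding is_cycle_complex_def by blast
  have small: "card F \<le> 2" if F: "F \<in> induced K W" for F
  proof -
    consider "F = {}" | v where "F = {v}" | i where "F = {vs ! i, vs ! ((i + 1) mod length vs)}"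
      using F unfolding Y by blast
    then show ?thesis by cases (simp_all add: card_insert_if)
  qed
  have "set vs = W"
  proof (intro equalityI subsetI)
    fix x assume "x \<in> set vs"
    then have "{x} \<in> induced K W" unfolding Y by blast
    then show "x \<in> W" by (simp add: induced_def)
  next
    fix x assume x: "x \<in> W"
    then have "{x} \<in> K" using vertex_face[OF K] W by blast
    then have "{x} \<in> induced K W" using x by (simp add: induced_def)
    then consider v where "v \<in> set vs" "{x} = {v}" | i where "i < length vs" "vs ! i \<in> {x}"
      unfolding Y by blast
    then show "x \<in> set vs" by cases auto
  qed
  then have card: "card W = length vs" using distinct_card[OF vs(1)] by simp
  obtain U where U: "induced K (V - {u}) = Pow U" using sx unfolding is_simplex_def by blast
  have "W - {u} \<subseteq> U"
  proof
    fix x assume x: "x \<in> W - {u}"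
    then have "{x} \<in> K" using vertex_face[OF K] W by blast
    moreover have "{x} \<subseteq> V - {u}" using x cpx_vertices[OF K \<open>{x} \<in> K\<close>] by blast
    ultimately have "{x} \<in> Pow U" using U by (metis induced_subset_iff)
    then show "x \<in> U" by simp
  qed
  then have "W - {u} \<in> induced K (V - {u})" unfolding U by blast
  then have "W - {u} \<in> induced K W" by (auto simp: induced_def)
  then have "card (W - {u}) \<le> 2" by (rule small)
  moreover have "finite W" using \<open>set vs = W\<close> by blast
  ultimately have c3: "card W = 3" using card vs(2) by (cases "u \<in> W") auto
  then have "length vs = 3" using card by simp
  have e: "{{vs ! i, vs ! ((i + 1) mod length vs)} | i. i < length vs}
      = {{vs ! 0, vs ! 1}, {vs ! 1, vs ! 2}, {vs ! 2, vs ! 0}}"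
  proof -
    have "{{vs ! i, vs ! ((i + 1) mod 3)} | i. i < 3} = (\<lambda>i. {vs ! i, vs ! ((i + 1) mod 3)}) ` {..<3}"
      by blast
    also have "{..<3} = {0, 1, 2 :: nat}" by auto
    finally show ?thesis unfolding \<open>length vs = 3\<close> by (simp add: numeral_2_eq_2)
  qed
  have W3: "W = {vs ! 0, vs ! 1, vs ! 2}"
  proof -
    have "W = (\<lambda>i. vs ! i) ` {..<3}"
      unfolding \<open>set vs = W\<close>[symmetric] \<open>length vs = 3\<close>[symmetric] by (auto simp: set_conv_nth)
    also have "{..<3} = {0, 1, 2 :: nat}" by auto
    finally show ?thesis by simp
  qed
  have edge: "{vs ! 0, vs ! 1} \<in> K" "{vs ! 1, vs ! 2} \<in> K" "{vs ! 2, vs ! 0} \<in> K"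
  proof -
    have "{{vs ! 0, vs ! 1}, {vs ! 1, vs ! 2}, {vs ! 2, vs ! 0}} \<subseteq> induced K W" unfolding Y e by blast
    then show "{vs ! 0, vs ! 1} \<in> K" "{vs ! 1, vs ! 2} \<in> K" "{vs ! 2, vs ! 0} \<in> K"
      by (simp_all add: induced_def)
  qed
  have "F \<in> K" if F: "F \<subset> W" for F
  proof -
    have "vs ! 0 \<notin> F \<or> vs ! 1 \<notin> F \<or> vs ! 2 \<notin> F" using F W3 by blast
    then have "F \<subseteq> {vs ! 1, vs ! 2} \<or> F \<subseteq> {vs ! 2, vs ! 0} \<or> F \<subseteq> {vs ! 0, vs ! 1}" using F W3 by blast
    then show ?thesis using edge cpx_down[OF K] by blast
  qed
  moreover have "W \<notin> K" using small[of W] c3 by (auto simp: induced_def)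
  ultimately show ?thesis using c3 unfolding hollow_def by blast
qed

text \<open>The distance is minimised to all of \<open>U\<close>, not to \<open>w\<close>, so the
  inner vertices avoid \<open>U\<close>. A chord or a repetition would shorten the path.\<close>

lemma shortest_path:
  assumes "(u, w) \<in> (adjacent X)\<^sup>*" "w \<in> U"
  obtains f n where "f 0 = u" "f n \<in> U" "\<And>i. i < n \<Longrightarrow> (f i, f (Suc i)) \<in> adjacent X"
    "inj_on f {..n}" "\<And>i. i < n \<Longrightarrow> f i \<notin> U"
    "\<And>i j. i < j \<Longrightarrow> j \<le> n \<Longrightarrow> {f i, f j} \<in> X \<Longrightarrow> j = Suc i"
proof -
  let ?R = "adjacent X" and ?P = "\<lambda>n. \<exists>w\<in>U. (u, w) \<in> adjacent X ^^ n"
  define n where "n = (LEAST n. ?P n)"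
  have "\<exists>n. ?P n" using assms rtrancl_imp_relpow by blast
  then have "?P n" unfolding n_def by (rule LeastI_ex)
  then obtain f where f0: "f 0 = u" and fn: "f n \<in> U" and step: "\<And>i. i < n \<Longrightarrow> (f i, f (Suc i)) \<in> ?R"
    by (auto simp: relpow_fun_conv)
  have min: "n \<le> m" if "w \<in> U" "(u, w) \<in> ?R ^^ m" for w m
    unfolding n_def by (rule Least_le) (use that in blast)
  have part: "(f i, f (i + k)) \<in> ?R ^^ k" if "i + k \<le> n" for i k
    unfolding relpow_fun_conv using that step by (intro exI[of _ "\<lambda>l. f (i + l)"]) simp
  have pre: "(u, f i) \<in> ?R ^^ i" if "i \<le> n" for i using part[of 0 i] that f0 by simp
  have suf: "(f j, f n) \<in> ?R ^^ (n - j)" if "j \<le> n" for j using part[of j "n - j"] that by simp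
  have "f i \<noteq> f j" if ij: "i < j" "j \<le> n" for i j
  proof
    assume "f i = f j"
    then have "(u, f n) \<in> ?R ^^ (i + (n - j))"
      using pre[of i] suf[of j] ij unfolding relpow_add by auto
    then show False using min[OF fn] ij by fastforce
  qed
  then have "inj_on f {..n}" by (metis (no_types, lifting) atMost_iff inj_onI nat_neq_iff)
  moreover have "f i \<notin> U" if "i < n" for i using min[OF _ pre[of i]] that by fastforce
  moreover have "j = Suc i" if ij: "i < j" "j \<le> n" "{f i, f j} \<in> X" for i j
  proof -
    have "f i \<noteq> f j" by (rule \<open>\<And>i j. i < j \<Longrightarrow> j \<le> n \<Longrightarrow> f i \<noteq> f j\<close>[OF ij(1,2)])
    then have "(f i, f j) \<in> ?R" using ij(3) by (simp add: adjacent_def)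
    then have "(u, f j) \<in> ?R ^^ Suc i" using pre[of i] ij by auto
    then have "(u, f n) \<in> ?R ^^ (Suc i + (n - j))"
      using suf[of j] ij(2) unfolding relpow_add by blast
    then have "n \<le> Suc i + (n - j)" by (rule min[OF fn])
    then show ?thesis using ij by simp
  qed
  ultimately show thesis using that[of f n] f0 fn step by simp
qed

text \<open>The interface of a nonbounding cycle is homologous in \<open>K\<close> to
  \<open>{u} + {w}\<close> for each \<open>w\<close> in \<open>U\<close>, and it bounds in
  \<open>X\<close>; so \<open>X\<close> connects \<open>u\<close> to \<open>U\<close>. The polygon
  found has such a pair of points as its interface, and this pair generates.\<close>

lemma graph_hole:
  assumes bX: "built 1 X" and s: "s \<subseteq> V" and sx: "is_simplex (induced X (s - {u}))"
    and nac: "\<not> acyclic_at (X \<union> Pow s) 2"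
  shows "\<exists>W. hole 2 (X \<union> Pow s) W \<and> generator (X \<union> Pow s) 2 (facet_sum (induced (X \<union> Pow s) W))"
proof -
  let ?K = "X \<inter> Pow s" and ?X' = "X \<union> Pow s"
  note X = built_cpx[OF bX] and K = built_cpx[OF built_Int[OF bX, of s]]
  have acX: "acyclic_at X (Suc 1)" by (rule built_acyclic[OF bX]) simp
  obtain U where U: "induced X (s - {u}) = Pow U" using sx unfolding is_simplex_def by blast
  then have "U \<in> induced X (s - {u})" by simp
  then have UX: "U \<in> X" "U \<subseteq> s" "u \<notin> U" by (auto simp: induced_def)
  have UK: "Pow U \<subseteq> ?K" using U[symmetric] by (auto simp: induced_def)
  have UV: "U \<subseteq> V" using UX(2) s by blast
  have KU: "x \<in> U" if "{x} \<in> ?K" "x \<noteq> u" for x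
  proof -
    have "{x} \<in> induced X (s - {u})" using that by (simp add: induced_def)
    then show ?thesis unfolding U by simp
  qed
  have acU: "acyclic_at (Pow U) 1" by (rule acyclic_simplex[OF UV]) simp
  \<comment> \<open>A cycle of points that avoids \<open>u\<close> is supported on the simplex
    \<open>U\<close>.\<close>
  have z_U: "z \<in> bounding ?K 1" if z: "z \<in> chains ?K 1" "bd z = 0" "z {u} = 0" for z
  proof -
    have "z \<in> chains (Pow U) 1"
    proof (rule chainsI)
      fix F assume F: "z F \<noteq> 0"
      then have FK: "F \<in> ?K" "card F = 1" using z(1) unfolding chains_def by blast+
      then obtain x where x: "F = {x}" using card_1_singletonE by blast
      moreover have "x \<noteq> u" using F z(3) x by metis
      ultimately have "x \<in> U" using FK(1) KU by blast
      then show "F \<in> Pow U \<and> card F = 1" using x by simp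
    qed
    then have "z \<in> bounding (Pow U) 1" using acU z(2) unfolding acyclic_at_def by blast
    then show ?thesis using bounding_mono[OF UK] by blast
  qed
  obtain z where z: "z \<in> chains ?X' (Suc 1)" "bd z = 0" "z \<notin> bounding ?X' (Suc 1)"
    using nac unfolding acyclic_at_def by (auto simp: numeral_2_eq_2)
  define y where "y = bd (restrict_chain X z)"
  have y: "y \<in> chains ?K 1" "bd y = 0" "y \<notin> bounding ?K 1"
    using interface_cycle[OF X s z(1,2)] bounding_glue[OF X s acX z(1,2)] z(3) unfolding y_def by auto
  have yX: "y \<in> bounding X 1"
    unfolding y_def bounding_def using restrict_chain_chains(1)[OF z(1)] by simp
  have yu: "y {u} \<noteq> 0" using z_U y by blast
  then have uK: "{u} \<in> ?K" by (rule chainsD[OF y(1)])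
  then have uV: "u \<in> V" using s by blast
  \<comment> \<open>With \<open>U\<close> empty, \<open>y\<close> would be the single point
    \<open>u\<close>, whose reduced boundary is the empty face.\<close>
  have "U \<noteq> {}"
  proof
    assume "U = {}"
    have "y F = face_chain {u} F" for F
    proof (cases "y F = 0")
      case True
      then show ?thesis using yu by (auto simp: face_chain_def)
    next
      case False
      then have "F \<in> ?K" "card F = 1" using y(1) unfolding chains_def by blast+
      then obtain x where "F = {x}" "{x} \<in> ?K" using card_1_singletonE by metis
      then have "F = {u}" using KU[of x] \<open>U = {}\<close> by auto
      then show ?thesis using False by (cases "y F") (auto simp: face_chain_def)
    qed
    then have "y = face_chain {u}" by (rule ext)
    then show False using y(2) bd_face_chain_vertex_empty[OF uV] by simp
  qed
  have edge_cycle: "face_chain {u} + face_chain {w} \<in> chains ?K 1 \<and>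
      bd (face_chain {u} + face_chain {w}) = 0" if "w \<in> U" for w
  proof -
    have "{w} \<in> ?K" using that UK by blast
    then have "face_chain {u} + face_chain {w} \<in> chains ?K 1"
      using uK by (intro chains_add face_chain_chains) simp_all
    moreover have "bd (face_chain {u, w}) = face_chain {u} + face_chain {w}"
      using that UX UV uV by (intro bd_face_chain_edge) auto
    then have "bd (face_chain {u} + face_chain {w}) = 0" by (metis bd_bd)
    ultimately show ?thesis by blast
  qed
  have gen: "generator ?K 1 (face_chain {u} + face_chain {w})" if w: "w \<in> U" for w
    unfolding generator_def
  proof (intro conjI ballI impI)
    fix x assume x: "x \<in> chains ?K 1" "bd x = 0"
    let ?g = "face_chain {u} + face_chain {w}"
    show "x \<in> bounding ?K 1 \<or> x + ?g \<in> bounding ?K 1"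
    proof (cases "x {u} = 0")
      case True
      then show ?thesis using z_U x by blast
    next
      case False
      have "{u} \<noteq> {w}" using w UX by auto
      then have "(x + ?g) {u} = 0" using False by (cases "x {u}") (auto simp: face_chain_def)
      moreover have "x + ?g \<in> chains ?K 1" using x(1) edge_cycle[OF w] by blast
      moreover have "bd (x + ?g) = 0" using x(2) edge_cycle[OF w] by (simp only: bd_add add_0_left)
      ultimately show ?thesis using z_U by blast
    qed
  qed (use edge_cycle[OF w] in auto)
  have y_edge: "y + (face_chain {u} + face_chain {w}) \<in> bounding ?K 1" if "w \<in> U" for w
    using gen[OF that] y unfolding generator_def by blast
  \<comment> \<open>An edge from \<open>u\<close> into \<open>U\<close> would lie in
    \<open>K\<close> and make \<open>{u} + {w}\<close>, and hence \<open>y\<close>, bound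
    there.\<close>
  have no_edge: "{u, w} \<notin> X" if w: "w \<in> U" for w
  proof
    assume "{u, w} \<in> X"
    then have e: "{u, w} \<in> ?K" using w UX uK by auto
    have ne: "u \<noteq> w" using w UX by auto
    have "face_chain {u, w} \<in> chains ?K (Suc 1)" by (rule face_chain_chains[OF e]) (simp add: ne)
    moreover have "bd (face_chain {u, w}) = face_chain {u} + face_chain {w}"
      using w UV uV ne by (intro bd_face_chain_edge) auto
    ultimately have "face_chain {u} + face_chain {w} \<in> bounding ?K 1" unfolding bounding_def by (metis imageI)
    from bounding_add[OF y_edge[OF w] this] show False using y(3) by (simp only: add.assoc chain_add_self add_0_right)
  qed
  obtain w where w: "w \<in> U" using \<open>U \<noteq> {}\<close> by blast
  have "y + (face_chain {u} + face_chain {w}) \<in> bounding X 1"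
    using y_edge[OF w] bounding_mono[of ?K X] by blast
  from bounding_add[OF yX this] have "face_chain {u} + face_chain {w} \<in> bounding X 1"
    by (simp only: chain_add_self_left)
  then have "(u, w) \<in> (adjacent X)\<^sup>*"
    using bounding_connected[OF X uV] w UV UX(3) by blast
  then obtain f n where f: "f 0 = u" "f n \<in> U" "\<And>i. i < n \<Longrightarrow> (f i, f (Suc i)) \<in> adjacent X"
    and inj: "inj_on f {..n}" and fU: "\<And>i. i < n \<Longrightarrow> f i \<notin> U"
    and short: "\<And>i j. i < j \<Longrightarrow> j \<le> n \<Longrightarrow> {f i, f j} \<in> X \<Longrightarrow> j = Suc i"
    using w by (rule shortest_path) blast
  have edge: "{f i, f (Suc i)} \<in> X" if "i < n" for i using f(3)[OF that] by (simp add: adjacent_def)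
  have vert: "{f i} \<in> X" if "i \<le> n" for i
  proof (cases "i = n")
    case True
    then show ?thesis using f(2) UK by blast
  next
    case False
    then show ?thesis using edge[of i] that cpx_down[OF X, of _ "{f i}"] by simp
  qed
  have n2: "n \<ge> 2"
  proof -
    have "n \<noteq> 0" using f(1,2) UX(3) by metis
    moreover have "n \<noteq> 1" using edge[of 0] f(1,2) no_edge by auto
    ultimately show ?thesis by simp
  qed
  let ?W = "f ` {..n}"
  have close: "{f 0, f n} \<subseteq> s" using f(1,2) uK UX(2) by blast
  have poly: "induced ?X' ?W = polygon f n"
  proof (intro equalityI subsetI)
    fix F assume F: "F \<in> polygon f n"
    then consider "F = {}" | i where "i \<le> n" "F = {f i}" | i where "i < n" "F = {f i, f (Suc i)}" | "F = {f 0, f n}"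
      unfolding polygon_def by blast
    then show "F \<in> induced ?X' ?W"
      unfolding induced_subset_iff
    proof cases
      case 1
      then show "F \<in> ?X' \<and> F \<subseteq> ?W" by simp
    next
      case 2
      then show "F \<in> ?X' \<and> F \<subseteq> ?W" using vert by simp
    next
      case 3
      then show "F \<in> ?X' \<and> F \<subseteq> ?W" using edge by simp
    next
      case 4
      then show "F \<in> ?X' \<and> F \<subseteq> ?W" using close by simp
    qed
  next
    fix F assume "F \<in> induced ?X' ?W"
    then have FW: "F \<subseteq> ?W" and "F \<in> X \<or> F \<subseteq> s" by (auto simp: induced_def)
    from this(2) show "F \<in> polygon f n"
    proof
      assume FX: "F \<in> X"
      have "F = {} \<or> (\<exists>i\<le>n. F = {f i}) \<or> (\<exists>i<n. F = {f i, f (Suc i)})"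
      proof (rule consecutive_pairs_only[OF inj FW])
        fix i j assume ij: "i < j" "j \<le> n" "f i \<in> F" "f j \<in> F"
        then have "{f i, f j} \<in> X" using cpx_down[OF X FX] by simp
        then show "j = Suc i" using short ij by blast
      qed
      then show ?thesis unfolding polygon_def by blast
    next
      \<comment> \<open>A vertex of the path that lies in \<open>s\<close> is \<open>u\<close> or
        belongs to \<open>U\<close>, so it is an end.\<close>
      assume Fs: "F \<subseteq> s"
      have "F \<subseteq> {f 0, f n}"
      proof
        fix x assume x: "x \<in> F"
        then obtain i where i: "i \<le> n" "x = f i" using FW by blast
        then have "{f i} \<in> ?K" using vert x Fs by blast
        then have "f i = f 0 \<or> f i \<in> U" using KU f(1) by metis
        then show "x \<in> {f 0, f n}" using fU[of i] i by (cases "i = n") auto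
      qed
      then have "F = {} \<or> F = {f 0} \<or> F = {f n} \<or> F = {f 0, f n}"
        by (cases "f 0 \<in> F"; cases "f n \<in> F") auto
      then show ?thesis unfolding polygon_def by blast
    qed
  qed
  have fsum: "facet_sum (induced ?X' ?W) = path_chain f n + face_chain {f 0, f n}"
  proof
    fix F
    have "{f 0, f n} \<noteq> {f i, f (Suc i)}" if "i < n" for i
      using no_edge[of "f n"] edge[OF that] f(1,2) by metis
    then have *: "\<not> ((\<exists>i<n. F = {f i, f (Suc i)}) \<and> F = {f 0, f n})" by metis
    have disjoint: "(if Q \<or> P then 1 else 0) = (if Q then 1 else 0) + (if P then 1 else (0::bit))"
      if "\<not> (Q \<and> P)" for P Q using that by simp
    have "F \<in> facets (polygon f n) \<longleftrightarrow> (\<exists>i<n. F = {f i, f (Suc i)}) \<or> F = {f 0, f n}"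
      unfolding facets_polygon[OF inj n2] by blast
    then show "facet_sum (induced ?X' ?W) F = (path_chain f n + face_chain {f 0, f n}) F"
      unfolding poly facet_sum_def plus_fun_apply path_chain_eq[OF inj] face_chain_def
      by (simp only: disjoint[OF *])
  qed
  have WV: "?W \<subseteq> V" using vert cpx_vertices[OF X] by blast
  have pX: "path_chain f n F \<noteq> 0 \<Longrightarrow> F \<in> X \<and> card F = 2" for F
  proof -
    assume "path_chain f n F \<noteq> 0"
    then obtain i where i: "i < n" "F = {f i, f (Suc i)}" unfolding path_chain_eq[OF inj] by (metis (full_types))
    moreover have "f i \<noteq> f (Suc i)" using f(3)[OF i(1)] by (simp add: adjacent_def)
    ultimately show ?thesis using edge by simp
  qed
  have bdp: "bd (path_chain f n) = face_chain {u} + face_chain {f n}"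
    using bd_path_chain[OF inj WV] f(1) by simp
  have fn: "f n \<noteq> u" using f(2) UX(3) by blast
  have "bd (face_chain {f 0, f n}) = face_chain {u} + face_chain {f n}"
    unfolding f(1) using WV by (intro bd_face_chain_edge uV) (use fn in auto)
  then have bdg: "bd (path_chain f n + face_chain {f 0, f n}) = 0"
    by (simp only: bd_add bdp chain_add_self)
  have "path_chain f n + face_chain {f 0, f n} \<in> chains ?X' (Suc 1)"
  proof (rule chains_add)
    show "path_chain f n \<in> chains ?X' (Suc 1)" by (rule chainsI) (use pX in auto)
    show "face_chain {f 0, f n} \<in> chains ?X' (Suc 1)"
      using close fn f(1) by (intro face_chain_chains) auto
  qed
  \<comment> \<open>Only the closing edge is outside \<open>X\<close>, so the interface cycle is the
    boundary of the path.\<close>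
  moreover have "restrict_chain X (path_chain f n + face_chain {f 0, f n}) = path_chain f n"
  proof
    fix F
    have "{f 0, f n} \<notin> X" using no_edge[OF f(2)] f(1) by simp
    moreover have "path_chain f n F = 0" if "F \<notin> X" using pX that by blast
    ultimately show "restrict_chain X (path_chain f n + face_chain {f 0, f n}) F = path_chain f n F"
      by (auto simp: restrict_chain_def face_chain_def)
  qed
  ultimately have "generator ?X' (Suc 1) (path_chain f n + face_chain {f 0, f n})"
    using generator_glue[OF X s acX _ bdg] gen[OF f(2)] bdp by simp
  moreover have "?W \<subseteq> \<Union>?X'" using vert by blast
  ultimately have "hole 2 ?X' ?W \<and> generator ?X' 2 (facet_sum (induced ?X' ?W))"
    unfolding hole_def fsum using is_cycle_polygon[OF inj n2] poly by (simp add: numeral_2_eq_2)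
  then show ?thesis by blast
qed


text \<open>In \<partial>2^\<mu> with \<mu> = \<tau> \<union> {v} the only facet outside
  \<open>X\<close> is \<tau>, so the connecting map sends this sphere to the generator
  \<partial>2^\<tau> of \<open>K\<close>.\<close>

lemma hollow_hole:
  assumes bX: "built k X" and k: "k \<ge> 2" and s: "s \<subseteq> V" and sx: "is_simplex (induced X (s - {u}))"
    and IH: "\<not> acyclic_at (X \<inter> Pow s) k \<Longrightarrow>
      \<exists>W. hole k (X \<inter> Pow s) W \<and> generator (X \<inter> Pow s) k (facet_sum (induced (X \<inter> Pow s) W))"
    and nac: "\<not> acyclic_at (X \<union> Pow s) (Suc k)"
  shows "\<exists>W. hole (Suc k) (X \<union> Pow s) W \<and>
    generator (X \<union> Pow s) (Suc k) (facet_sum (induced (X \<union> Pow s) W))"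
proof -
  let ?K = "X \<inter> Pow s" and ?X' = "X \<union> Pow s"
  note X = built_cpx[OF bX] and K = built_cpx[OF built_Int[OF bX, of s]]
  have acX: "acyclic_at X (Suc k)" by (rule built_acyclic[OF bX order_refl])
  obtain z where z: "z \<in> chains ?X' (Suc k)" "bd z = 0" "z \<notin> bounding ?X' (Suc k)"
    using nac unfolding acyclic_at_def by blast
  define y where "y = bd (restrict_chain X z)"
  have y: "y \<in> chains ?K k" "bd y = 0" "y \<notin> bounding ?K k"
    using interface_cycle[OF X s z(1,2)] bounding_glue[OF X s acX z(1,2)] z(3) unfolding y_def by auto
  have yX: "y \<in> bounding X k"
    unfolding y_def bounding_def using restrict_chain_chains(1)[OF z(1)] by simp
  have "\<not> acyclic_at ?K k" using y unfolding acyclic_at_def by blast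
  from IH[OF this] obtain \<tau> where \<tau>: "hole k ?K \<tau>" and gen: "generator ?K k (facet_sum (induced ?K \<tau>))"
    by blast
  have "hollow ?K \<tau> \<and> card \<tau> = Suc k"
  proof (cases "k = 2")
    case True
    have "induced ?K (V - {u}) = induced X (s - {u})" using s by (auto simp: induced_def)
    then have "is_simplex (induced ?K (V - {u}))" using sx by simp
    then show ?thesis using cycle_in_cone[OF K, of \<tau> u] \<tau> True unfolding hole_def by simp
  next
    case False
    then show ?thesis using \<tau> unfolding hole_def by simp
  qed
  then have hK: "hollow ?K \<tau>" and card: "card \<tau> = Suc k" by blast+
  have \<tau>s: "\<tau> \<subseteq> s" using hollow_vertices[OF hK] card k by auto
  then have \<tau>X: "\<tau> \<notin> X" using hK unfolding hollow_def by blast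
  have hX: "hollow X \<tau>" using hK \<tau>X unfolding hollow_def by blast
  have \<tau>V: "\<tau> \<subseteq> V" using \<tau>s s by blast
  have fin: "finite \<tau>" using \<tau>V finite_V finite_subset by blast
  let ?g = "bd (face_chain \<tau>)"
  have genK: "generator ?K k ?g" using gen facet_sum_hollow[OF hK \<tau>V] by simp
  \<comment> \<open>As \<open>y\<close> does not bound in \<open>K\<close>, it is homologous there
    to the generator \<open>?g\<close>; since \<open>y\<close> bounds in \<open>X\<close>, so does
    \<open>?g\<close>.\<close>
  then have yg: "y + ?g \<in> bounding ?K k" using y unfolding generator_def by blast
  then have "y + ?g \<in> bounding X k" using bounding_mono[of ?K X] by blast
  from bounding_add[OF yX this] have "?g \<in> bounding X k" by (simp only: chain_add_self_left)
  then obtain v where v: "\<And>F. F \<subset> \<tau> \<Longrightarrow> insert v F \<in> X"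
    using cone_vertex[OF bX hX card _ k] by blast
  have "\<tau> \<noteq> {}" using card by (metis card.empty nat.distinct(1))
  then have "{v} \<in> X" by (intro v) blast
  then have vV: "v \<in> V" using cpx_vertices[OF X] by blast
  \<comment> \<open>An apex in \<open>s\<close> would put the cone over \<partial>2^\<tau> inside
    \<open>K\<close>, so \<open>?g\<close>, and with it \<open>y\<close>, would bound there.\<close>
  have vs: "v \<notin> s"
  proof
    assume vs: "v \<in> s"
    have "?g \<in> chains (Pow \<tau> - {\<tau>}) k"
      by (rule bd_face_chain_hollow[OF \<tau>V _ card]) (auto simp: hollow_def)
    then have "cone v ?g \<in> chains ?K (Suc k)"
    proof (rule cone_chains)
      fix F assume F: "F \<in> Pow \<tau> - {\<tau>}"
      then have "F \<subset> \<tau>" by blast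
      then show "insert v F \<in> ?K" "finite F" using v vs \<tau>s fin finite_subset by auto
    qed
    moreover have "bd (cone v ?g) = ?g" using bd_cone[OF vV, of ?g] by (simp add: cone_def fun_eq_iff)
    ultimately have "?g \<in> bounding ?K k" unfolding bounding_def by (metis imageI)
    from bounding_add[OF yg this] show False using y(3) by (simp only: add.assoc chain_add_self add_0_right)
  qed
  let ?\<mu> = "insert v \<tau>"
  have v\<tau>: "v \<notin> \<tau>" using vs \<tau>s by blast
  have \<mu>V: "?\<mu> \<subseteq> V" using \<tau>V vV by blast
  have card\<mu>: "card ?\<mu> = Suc (Suc k)" using card fin v\<tau> by simp
  have \<mu>X: "F \<in> X" if F: "F \<subset> ?\<mu>" "v \<in> F" for F
  proof -
    have "F - {v} \<subset> \<tau>" using F by blast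
    then have "insert v (F - {v}) \<in> X" by (rule v)
    then show ?thesis using F(2) by (simp add: insert_absorb)
  qed
  have h\<mu>: "hollow ?X' ?\<mu>"
    unfolding hollow_def
  proof (intro conjI allI impI)
    show "?\<mu> \<notin> ?X'" using vs \<tau>X cpx_down[OF X, of ?\<mu> \<tau>] by blast
    fix F assume F: "F \<subset> ?\<mu>"
    show "F \<in> ?X'"
    proof (cases "v \<in> F")
      case False
      then have "F \<subseteq> s" using F \<tau>s by blast
      then show ?thesis by blast
    qed (use \<mu>X[OF F] in blast)
  qed
  let ?h = "bd (face_chain ?\<mu>)"
  have "restrict_chain X ?h = ?h + face_chain \<tau>"
  proof
    fix F
    have \<tau>1: "?h \<tau> = 1" using bd_face_chain_Diff[OF \<mu>V, of v] v\<tau> by simp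
    show "restrict_chain X ?h F = (?h + face_chain \<tau>) F"
    proof (cases "F = \<tau>")
      case True
      then show ?thesis using \<tau>1 \<tau>X by (simp add: restrict_chain_def)
    next
      case False
      have "F \<in> X" if nz: "?h F \<noteq> 0"
      proof -
        obtain x where x: "x \<in> ?\<mu>" "F = ?\<mu> - {x}" using bd_face_chain_neq_0[OF \<mu>V nz] by blast
        then have "x \<noteq> v" using False v\<tau> by auto
        then show ?thesis using x by (intro \<mu>X) auto
      qed
      then show ?thesis using False by (auto simp: restrict_chain_def face_chain_def)
    qed
  qed
  then have "bd (restrict_chain X ?h) = ?g" by simp
  then have "generator ?X' (Suc k) ?h"
    using generator_glue[OF X s acX bd_face_chain_hollow[OF \<mu>V h\<mu> card\<mu>] bd_bd] genK by simp
  moreover have "?\<mu> \<subseteq> \<Union>?X'" by (rule hollow_vertices[OF h\<mu>]) (simp add: card\<mu>)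
  ultimately have "hole (Suc k) ?X' ?\<mu> \<and> generator ?X' (Suc k) (facet_sum (induced ?X' ?\<mu>))"
    unfolding hole_def using h\<mu> card\<mu> k facet_sum_hollow[OF h\<mu> \<mu>V] by simp
  then show ?thesis by blast
qed

text \<open>Attaching along a simplex preserves both the generator and the induced subcomplex on the
  hole, so only weak steps require a new hole.\<close>

lemma built_generator:
  assumes "built k X" "k \<ge> 2" "\<not> acyclic_at X k"
  shows "\<exists>W. hole k X W \<and> generator X k (facet_sum (induced X W))"
  using assms
proof (induction rule: built_strong_induct)
  case (simplex U)
  then show ?case by simp
next
  case (glue k X s)
  note X = built_cpx[OF glue.hyps(1)]
  obtain n where n: "k = Suc n" "n \<ge> 1" using glue.prems(1) by (cases k) auto
  have ac: "acyclic_at (X \<inter> Pow s) n" by (rule acyclic_is_simplex[OF X glue.hyps(3) n(2)])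
  have "\<not> acyclic_at X k" using acyclic_glue[OF X glue.hyps(2) _ ac] glue.prems(2) n(1) by blast
  from glue.IH[OF glue.prems(1) this] obtain W
    where W: "hole k X W" "generator X k (facet_sum (induced X W))" by blast
  have eq: "induced (X \<union> Pow s) W = induced X W"
    using induced_glue_simplex[OF X glue.hyps(3)] W(1) unfolding hole_def by blast
  have "generator (X \<union> Pow s) k (facet_sum (induced X W))"
    using generator_glue_simplex[OF X glue.hyps(2) ac] W(2) n(1) by simp
  moreover have "hole k (X \<union> Pow s) W"
  proof (cases "k = 2")
    case True
    then show ?thesis using W(1) eq unfolding hole_def by auto
  next
    case False
    have "W \<in> X \<union> Pow s \<longleftrightarrow> W \<in> induced (X \<union> Pow s) W" by (simp add: induced_def)
    also have "\<dots> \<longleftrightarrow> W \<in> X" unfolding eq by (simp add: induced_def)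
    finally show ?thesis using W(1) False unfolding hole_def hollow_def by auto
  qed
  ultimately show ?case using eq by metis
next
  case (weak_glue k X s u)
  show ?case
  proof (cases "k \<ge> 2")
    case True
    show ?thesis
      using hollow_hole[OF weak_glue.hyps(1) True weak_glue.hyps(2,3) weak_glue.IH[OF built_Int[OF weak_glue.hyps(1)] True]
          weak_glue.prems(2)] by blast
  next
    case False
    then have "k = 1" using weak_glue.prems(1) by simp
    then show ?thesis using graph_hole[of X s u] weak_glue.hyps weak_glue.prems(2) by (simp add: numeral_2_eq_2)
  qed
qed

subsection \<open>Comparison with the homology modules\<close>

lemma chain_space_eq: "carrier (chain_space X (int n)) = chains X (Suc n)"
proof -
  have "int m = int n + 1 \<longleftrightarrow> m = Suc n" for m by linarith
  then show ?thesis by (auto simp: chain_space_def chains_def faces_of_dim_def)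
qed

lemma boundary_eq_bd:
  assumes X: "cpx X" and c: "c \<in> chains X (Suc n)"
  shows "boundary X (int n) c = bd c"
proof
  fix G
  let ?S = "{F \<in> faces_of_dim X (int n). \<exists>v\<in>F. G = F - {v}}" and ?T = "(\<lambda>v. insert v G) ` (V - G)"
  have "sum c ?T = sum c ?S"
  proof (rule sum.mono_neutral_right)
    show "?S \<subseteq> ?T"
    proof
      fix F assume "F \<in> ?S"
      then obtain v where v: "F \<in> X" "v \<in> F" "G = F - {v}" by (auto simp: faces_of_dim_def)
      then have "F = insert v G" "v \<in> V - G" using cpx_vertices[OF X v(1)] by auto
      then show "F \<in> ?T" by (rule image_eqI)
    qed
    show "\<forall>F\<in>?T - ?S. c F = 0"
    proof
      fix F assume F: "F \<in> ?T - ?S"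
      then obtain v where v: "v \<in> V - G" "F = insert v G" by blast
      then have "G = F - {v}" "v \<in> F" by auto
      then have "F \<notin> faces_of_dim X (int n)" using F by blast
      then show "c F = 0" using c by (auto simp: chains_def faces_of_dim_def)
    qed
  qed (use finite_V in simp)
  moreover have "inj_on (\<lambda>v. insert v G) (V - G)" by (rule inj_onI) auto
  ultimately show "boundary X (int n) c G = bd c G"
    unfolding boundary_def bd_def by (simp add: sum.reindex)
qed

lemma cycles_eq: "cpx X \<Longrightarrow> cycles X (int n) = {z \<in> chains X (Suc n). bd z = 0}"
  using boundary_eq_bd[of X _ n] unfolding cycles_def chain_space_eq zero_fun_def by auto

lemma boundaries_eq: "cpx X \<Longrightarrow> boundaries X (int n) = bounding X (Suc n)"
proof -
  assume X: "cpx X"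
  have "int n + 1 = int (Suc n)" by simp
  then show ?thesis
    unfolding boundaries_def bounding_def using chain_space_eq[of X "Suc n"] boundary_eq_bd[OF X, of _ "Suc n"]
    by (metis (no_types, lifting) image_cong)
qed

lemma homology_class_eq_iff:
  assumes X: "cpx X"
  shows "homology_class X (int n) c = homology_class X (int n) d \<longleftrightarrow> c + d \<in> bounding X (Suc n)"
proof -
  let ?B = "bounding X (Suc n)"
  have eq: "homology_class X (int n) c = {b + c | b. b \<in> ?B}" for c
    unfolding homology_class_eq boundaries_eq[OF X] plus_fun_def ..
  show ?thesis
  proof
    assume "homology_class X (int n) c = homology_class X (int n) d"
    moreover have "c \<in> homology_class X (int n) c"
      unfolding eq by (rule CollectI, rule exI[of _ 0]) simp
    ultimately obtain b where "b \<in> ?B" "c = b + d" unfolding eq by blast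
    then show "c + d \<in> ?B" by (simp add: add.assoc)
  next
    assume cd: "c + d \<in> ?B"
    have sub: "{b + c | b. b \<in> ?B} \<subseteq> {b + d | b. b \<in> ?B}" if cd: "c + d \<in> ?B" for c d
    proof
      fix x assume "x \<in> {b + c | b. b \<in> ?B}"
      then obtain b where b: "b \<in> ?B" "x = b + c" by blast
      have "x = (b + (c + d)) + d" unfolding b(2) by (simp add: add.assoc)
      then show "x \<in> {b + d | b. b \<in> ?B}" using bounding_add[OF b(1) cd] by blast
    qed
    then show "homology_class X (int n) c = homology_class X (int n) d"
      unfolding eq using sub[OF cd] sub[of d c] cd by (simp add: add.commute subset_antisym)
  qed
qed

lemma homology_zero_iff:
  assumes X: "cpx X"
  shows "homology_zero X (int n) \<longleftrightarrow> acyclic_at X (Suc n)"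
proof -
  have eq: "homology_class X (int n) z = homology_class X (int n) 0 \<longleftrightarrow> z \<in> bounding X (Suc n)" for z
    using homology_class_eq_iff[OF X, of n z 0] by simp
  have 0: "0 \<in> cycles X (int n)" unfolding cycles_eq[OF X] by simp
  have "homology_zero X (int n) \<longleftrightarrow> (\<forall>z\<in>cycles X (int n). homology_class X (int n) z = homology_class X (int n) 0)"
    unfolding homology_zero_def homology_simps zero_fun_def[symmetric] using 0 by blast
  then show ?thesis unfolding eq acyclic_at_def cycles_eq[OF X] by blast
qed

end

lemma Union_proper_subsets: "card A \<ge> 2 \<Longrightarrow> \<Union>(Pow A - {A}) = A"
  using hollow_vertices[of "Pow A - {A}" A] by (auto simp: hollow_def)

context finite_vertices
begin

lemma generator_homology:
  assumes X: "cpx X" and g: "generator X (Suc n) g"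
  shows "carrier (homology X (int n)) =
      {\<zero>\<^bsub>homology X (int n)\<^esub>, homology_class X (int n) g}"
    and "g \<in> cycles X (int n)"
proof -
  show gc: "g \<in> cycles X (int n)" using g unfolding cycles_eq[OF X] generator_def by blast
  have 0: "0 \<in> cycles X (int n)" unfolding cycles_eq[OF X] by simp
  have "homology_class X (int n) z = homology_class X (int n) 0 \<or>
      homology_class X (int n) z = homology_class X (int n) g" if "z \<in> cycles X (int n)" for z
    using that g unfolding cycles_eq[OF X] generator_def homology_class_eq_iff[OF X] by simp
  then show "carrier (homology X (int n)) =
      {\<zero>\<^bsub>homology X (int n)\<^esub>, homology_class X (int n) g}"
    unfolding homology_simps zero_fun_def[symmetric] using 0 gc by blast
qed

lemma generator_corresponds:
  assumes X: "cpx X" and g: "generator X (Suc n) (facet_sum Y)"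
  shows "corresponds_to_generator X (int n) Y"
proof -
  let ?H = "homology X (int n)" and ?x = "homology_class X (int n) (facet_sum Y)"
  interpret vectorspace F2 ?H by (rule homology_vectorspace)
  note c = generator_homology[OF X g]
  have x: "?x \<in> carrier ?H" using c(1) by blast
  have "generate (add_monoid ?H) {?x} \<subseteq> carrier ?H"
    using group.generate_incl[OF a_group, of "{?x}"] x by simp
  moreover have "\<zero>\<^bsub>?H\<^esub> \<in> generate (add_monoid ?H) {?x}"
    using generate.one[of "add_monoid ?H" "{?x}"] by simp
  moreover have "?x \<in> generate (add_monoid ?H) {?x}" by (rule generate.incl) simp
  ultimately have "generate (add_monoid ?H) {?x} = carrier ?H" unfolding c(1) by blast
  then show ?thesis unfolding corresponds_to_generator_def using c(2) by blast
qed

lemma generator_dim: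
  assumes X: "cpx X" and g: "generator X (Suc n) g"
  shows "homology_dim X (int n) \<le> 1"
proof -
  let ?H = "homology X (int n)" and ?x = "homology_class X (int n) g"
  interpret vectorspace F2 ?H by (rule homology_vectorspace)
  note c = generator_homology[OF X g]
  have x: "?x \<in> carrier ?H" using c(1) by blast
  then have "submodule F2 (span {?x}) ?H" by (intro span_is_submodule) simp
  then have "\<zero>\<^bsub>?H\<^esub> \<in> span {?x}" by (rule submodule.zero_closed)
  moreover have "?x \<in> span {?x}" using in_own_span[of "{?x}"] x by simp
  moreover have "span {?x} \<subseteq> carrier ?H" using x by (intro span_is_subset2) simp
  ultimately have "gen_set {?x}" unfolding c(1) by blast
  then show ?thesis unfolding homology_dim_def using dim_le1I x by blast
qed

section \<open>Weak shellings as constructions, and the Leray number\<close>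

lemma weak_shelling_built:
  assumes X: "cpx X" and ws: "weak_shelling V X s"
  shows "j < length s \<Longrightarrow> built (M_prefix s (Suc j)) (prefix_complex s (Suc j))"
proof (induction j)
  case 0
  have "s ! 0 \<in> facets X"
    using ws 0 nth_mem[of 0 s] unfolding weak_shelling_def facet_orders_def permutations_of_set_def by auto
  then have "s ! 0 \<subseteq> V" using cpx_vertices[OF X] unfolding facets_def by blast
  moreover have "prefix_complex s (Suc 0) = Pow (s ! 0)" by (auto simp: prefix_complex_def)
  ultimately show ?case using built.simplex by simp
next
  case (Suc j)
  let ?P = "prefix_complex s (Suc j)" and ?\<sigma> = "s ! Suc j"
  have "?\<sigma> \<in> facets X"
    using ws Suc.prems nth_mem[of "Suc j" s]
    unfolding weak_shelling_def facet_orders_def permutations_of_set_def by auto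
  then have \<sigma>: "?\<sigma> \<subseteq> V" using cpx_vertices[OF X] unfolding facets_def by blast
  have P: "built (M_prefix s (Suc j)) ?P" using Suc by simp
  have eq: "prefix_complex s (Suc (Suc j)) = ?P \<union> Pow ?\<sigma>"
    unfolding prefix_complex_def lessThan_Suc[of "Suc j"] by (simp add: Un_commute)
  show ?case
  proof (cases "is_simplex (?P \<inter> Pow ?\<sigma>)")
    case True
    then show ?thesis unfolding eq using built.glue[OF P \<sigma>] by simp
  next
    case False
    \<comment> \<open>Weak shellings number the facets from 1, so \<open>s ! Suc j\<close> is facet
      number \<open>Suc (Suc j)\<close>.\<close>
    have "Suc (Suc j) \<in> {2..length s}" using Suc.prems by simp
    then obtain u where "is_simplex (induced ?P (?\<sigma> - {u}))"
      using ws unfolding weak_shelling_def by (metis (no_types, lifting) diff_Suc_1)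
    then show ?thesis unfolding eq using False built.weak_glue[OF P \<sigma>] by simp
  qed
qed

lemma weak_shelling_built_complex:
  assumes X: "cpx X" "X \<noteq> {}" and ws: "weak_shelling V X s"
  shows "built (M_order s) X"
proof -
  have set: "set s = facets X"
    using ws unfolding weak_shelling_def facet_orders_def permutations_of_set_def by blast
  have finX: "finite X" using X(1) unfolding simplicial_complex_def by (meson finite_Pow_iff finite_subset)
  have facet: "\<exists>G\<in>facets X. F \<subseteq> G" if "F \<in> X" for F
    using finite_has_maximal2[OF finX that] unfolding facets_def by auto
  have "prefix_complex s (length s) = (\<Union>F\<in>facets X. Pow F)"
    unfolding prefix_complex_def set[symmetric] by (auto simp: set_conv_nth)
  also have "\<dots> = X"
  proof (intro equalityI subsetI)
    fix F assume "F \<in> (\<Union>F\<in>facets X. Pow F)"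
    then obtain G where "G \<in> X" "F \<subseteq> G" unfolding facets_def by blast
    then show "F \<in> X" using cpx_down[OF X(1)] by blast
  next
    fix F assume "F \<in> X"
    then show "F \<in> (\<Union>F\<in>facets X. Pow F)" using facet by blast
  qed
  finally have eq: "prefix_complex s (length s) = X" .
  \<comment> \<open>A nonvoid complex has a facet, so \<open>M_order s\<close> is not the dummy
    value of \<open>M_prefix\<close> at 0.\<close>
  have "s \<noteq> []" using facet X(2) set by fastforce
  then obtain j where "length s = Suc j" by (cases s) auto
  then show ?thesis using weak_shelling_built[OF X(1) ws, of j] eq unfolding M_order_def by simp
qed

text \<open>No face has more than \<open>card V\<close> vertices. The point is that some bound
  exists, so the \<open>LEAST\<close> in \<open>leray_number\<close> is attained.\<close>

lemma leray_card: "cpx X \<Longrightarrow> leray V (card V) X"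
  unfolding leray_def
proof (intro allI impI)
  fix i W assume X: "cpx X" and i: "int (card V) \<le> i" and "W \<subseteq> V"
  obtain n where n: "i = int n" "card V \<le> n" using i nonneg_int_cases[of i] by force
  note Y = cpx_induced[OF X, of W]
  have "z = 0" if z: "z \<in> chains (induced X W) (Suc n)" for z
  proof
    fix F show "z F = 0 F"
    proof (rule ccontr)
      assume "z F \<noteq> 0 F"
      then have "F \<in> induced X W" "card F = Suc n" using z unfolding chains_def by auto
      then show False using card_mono[OF finite_V cpx_vertices[OF Y, of F]] n(2) by simp
    qed
  qed
  then have "acyclic_at (induced X W) (Suc n)" unfolding acyclic_at_def by blast
  then show "homology_zero (induced X W) i" unfolding n(1) homology_zero_iff[OF Y] .
qed

text \<open>Every induced subcomplex is again a simplex. The contrapositive is what counts: a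
  positive Leray number excludes simplices.\<close>

lemma leray_simplex:
  assumes X: "cpx X" and sx: "is_simplex X"
  shows "leray_number V X = 0"
proof -
  obtain U where U: "X = Pow U" using sx unfolding is_simplex_def by blast
  then have UV: "U \<subseteq> V" using cpx_vertices[OF X, of U] by simp
  have "leray V 0 X"
    unfolding leray_def
  proof (intro allI impI)
    fix i W assume "int 0 \<le> i" "W \<subseteq> V"
    then obtain n where n: "i = int n" using nonneg_int_cases[of i] by auto
    have "induced X W = Pow (U \<inter> W)" unfolding U by (auto simp: induced_def)
    then have "acyclic_at (induced X W) (Suc n)" using acyclic_simplex[of "U \<inter> W" "Suc n"] UV by auto
    then show "homology_zero (induced X W) i" unfolding n homology_zero_iff[OF cpx_induced[OF X]] .
  qed
  then have "leray_number V X \<le> 0" unfolding leray_number_def by (rule Least_le)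
  then show ?thesis by simp
qed

text \<open>Minimality gives nonvanishing in some dimension at least \<open>n\<close>, and the Leray
  property gives vanishing from \<open>n + 1\<close> on; only dimension \<open>n\<close>
  remains.\<close>

lemma leray_number_witness:
  assumes X: "cpx X" and L: "leray_number V X = Suc n"
  shows "\<exists>W\<subseteq>V. \<not> homology_zero (induced X W) (int n)"
proof -
  have "leray V (Suc n) X"
    using LeastI[of "\<lambda>d. leray V d X", OF leray_card[OF X]] L unfolding leray_number_def by simp
  moreover have "\<not> leray V n X"
    using not_less_Least[of n "\<lambda>d. leray V d X"] L unfolding leray_number_def by simp
  then obtain i W where i: "int n \<le> i" "W \<subseteq> V" "\<not> homology_zero (induced X W) i"
    unfolding leray_def by blast
  ultimately have "\<not> int (Suc n) \<le> i" unfolding leray_def by blast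
  then have "i = int n" using i(1) by simp
  then show ?thesis using i by blast
qed

lemma isomorphic_hollow:
  assumes h: "hollow X \<tau>" and card: "card \<tau> = n" "n \<ge> 2"
  shows "isomorphic_complexes (induced X \<tau>) (simplex_boundary n)"
proof -
  have fin: "finite \<tau>" using card by (metis card.infinite not_numeral_le_zero)
  obtain f where f: "bij_betw f \<tau> {..<n}"
    using ex_bij_betw_finite_nat[OF fin] card(1) by (auto simp: atLeast0LessThan)
  have "(\<lambda>F. f ` F) ` (Pow \<tau> - {\<tau>}) = (\<lambda>F. f ` F) ` Pow \<tau> - {f ` \<tau>}"
    using inj_on_image_set_diff[OF bij_betw_imp_inj_on[OF bij_betw_Pow[OF f]], of "Pow \<tau>" "{\<tau>}"] by simp
  also have "\<dots> = simplex_boundary n"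
    using bij_betw_imp_surj_on[OF bij_betw_Pow[OF f]] bij_betw_imp_surj_on[OF f]
    unfolding simplex_boundary_def by simp
  finally have "simplex_boundary n = (\<lambda>F. f ` F) ` (Pow \<tau> - {\<tau>})" by simp
  moreover have "\<Union>(Pow \<tau> - {\<tau>}) = \<tau>" "\<Union>(simplex_boundary n) = {..<n}"
    unfolding simplex_boundary_def using card by (simp_all add: Union_proper_subsets)
  ultimately show ?thesis unfolding isomorphic_complexes_def induced_hollow[OF h] using f by metis
qed

lemma built_homology:
  assumes bX: "built (Suc n) X" and n: "n \<ge> 1" and nz: "\<not> homology_zero (induced X W) (int n)"
  obtains W' where "W' \<subseteq> W" "corresponds_to_generator (induced X W) (int n) (induced X W')"
    "n = 1 \<Longrightarrow> is_cycle_complex (induced X W')"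
    "n \<ge> 2 \<Longrightarrow> isomorphic_complexes (induced X W') (simplex_boundary (Suc (Suc n)))"
proof -
  let ?Y = "induced X W"
  note bY = built_induced[OF bX, of W] and Y = cpx_induced[OF built_cpx[OF bX], of W]
  have "\<not> acyclic_at ?Y (Suc n)" using nz homology_zero_iff[OF Y] by simp
  then obtain W' where h: "hole (Suc n) ?Y W'" and g: "generator ?Y (Suc n) (facet_sum (induced ?Y W'))"
    using built_generator[OF bY] n by auto
  have sub: "W' \<subseteq> W" using h unfolding hole_def induced_def by blast
  then have eq: "induced ?Y W' = induced X W'" by (auto simp: induced_def)
  show thesis
  proof (rule that[OF sub])
    show "corresponds_to_generator ?Y (int n) (induced X W')" using generator_corresponds[OF Y] g eq by simp
    show "is_cycle_complex (induced X W')" if "n = 1" using h that eq unfolding hole_def by simp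
    show "isomorphic_complexes (induced X W') (simplex_boundary (Suc (Suc n)))" if "n \<ge> 2"
      using isomorphic_hollow[of ?Y W'] h that eq unfolding hole_def by simp
  qed
qed

lemma built_homology_dim:
  assumes bX: "built (Suc n) X" and n: "n \<ge> 1"
  shows "homology_dim (induced X W) (int n) \<le> 1"
proof -
  note bY = built_induced[OF bX, of W] and Y = cpx_induced[OF built_cpx[OF bX], of W]
  have "\<exists>g. generator (induced X W) (Suc n) g"
  proof (cases "acyclic_at (induced X W) (Suc n)")
    case True
    then have "generator (induced X W) (Suc n) 0" unfolding generator_def acyclic_at_def by simp
    then show ?thesis by blast
  next
    case False
    then show ?thesis using built_generator[OF bY] n by auto
  qed
  then show ?thesis using generator_dim[OF Y] by blast
qed

end

theorem theorem4p1:
  fixes V :: "'a set" and X :: "'a set set"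
  assumes "simplicial_complex V X" and "X \<noteq> {}"
    and "leray_number V X = M_number X"
    and "\<exists>s. weak_shelling V X s \<and> M_order s = M_number X"
  shows
    "(leray_number V X = 1 \<longleftrightarrow> M_number X = 1 \<and> \<not> is_simplex X)
     \<and>
     (leray_number V X = 2 \<longleftrightarrow>
        M_number X = 2 \<and> (\<exists>W\<subseteq>V. \<not> homology_zero (induced X W) 1))
     \<and>
     (leray_number V X = 2 \<longrightarrow>
        (\<forall>W\<subseteq>V. \<not> homology_zero (induced X W) 1 \<longrightarrow>
           (\<exists>W'\<subseteq>W. is_cycle_complex (induced X W') \<and>
              corresponds_to_generator (induced X W) 1 (induced X W'))))
     \<and>
     (\<forall>k\<ge>3.
        (leray_number V X = k \<longleftrightarrow>
           M_number X = k \<and> (\<exists>W\<subseteq>V. \<not> homology_zero (induced X W) (int k - 1)))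
        \<and>
        (leray_number V X = k \<longrightarrow>
           (\<forall>W\<subseteq>V. \<not> homology_zero (induced X W) (int k - 1) \<longrightarrow>
              (\<exists>W'\<subseteq>W. isomorphic_complexes (induced X W') (simplex_boundary (k + 1)) \<and>
                 corresponds_to_generator (induced X W) (int k - 1) (induced X W')))))
     \<and>
     (\<forall>k\<ge>2. leray_number V X = k \<longrightarrow>
        (\<forall>W\<subseteq>V. homology_dim (induced X W) (int k - 1) \<le> 1))"
proof -
  interpret finite_vertices V
    by unfold_locales (use assms(1) in \<open>simp add: simplicial_complex_def\<close>)
  obtain s where s: "weak_shelling V X s" "M_order s = M_number X" using assms(4) by blast
  have bX: "built (leray_number V X) X"
    using weak_shelling_built_complex[OF assms(1,2) s(1)] s(2) assms(3) by simp
  \<comment> \<open>An index is at least 1, whereas a simplex has Leray number 0.\<close>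
  have simplex: "\<not> is_simplex X"
    using leray_simplex[OF assms(1)] built_pos[OF bX] by auto
  have witness: "\<exists>W\<subseteq>V. \<not> homology_zero (induced X W) (int k - 1)" if L: "leray_number V X = k" "k \<ge> 2" for k
  proof -
    obtain n where n: "k = Suc n" using L(2) by (cases k) auto
    then show ?thesis using leray_number_witness[OF assms(1), of n] L(1) by simp
  qed
  have cycle: "\<exists>W'\<subseteq>W. is_cycle_complex (induced X W') \<and>
      corresponds_to_generator (induced X W) 1 (induced X W')"
    if "leray_number V X = 2" and nz: "\<not> homology_zero (induced X W) 1" for W
  proof -
    have "built (Suc 1) X" using bX that(1) by (simp add: numeral_2_eq_2)
    then obtain W' where "W' \<subseteq> W" "corresponds_to_generator (induced X W) (int 1) (induced X W')"
      "(1::nat) = 1 \<Longrightarrow> is_cycle_complex (induced X W')"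
      by (rule built_homology) (use nz in simp_all)
    then show ?thesis by auto
  qed
  have boundary: "\<exists>W'\<subseteq>W. isomorphic_complexes (induced X W') (simplex_boundary (k + 1)) \<and>
      corresponds_to_generator (induced X W) (int k - 1) (induced X W')"
    if L: "leray_number V X = k" "k \<ge> 3" and nz: "\<not> homology_zero (induced X W) (int k - 1)" for k W
  proof -
    obtain n where n: "k = Suc n" "n \<ge> 2" using L(2) by (cases k) auto
    then have "built (Suc n) X" using bX L(1) by simp
    then obtain W' where "W' \<subseteq> W" "corresponds_to_generator (induced X W) (int n) (induced X W')"
      "n \<ge> 2 \<Longrightarrow> isomorphic_complexes (induced X W') (simplex_boundary (Suc (Suc n)))"
      by (rule built_homology) (use nz n in simp_all)
    then show ?thesis using n by auto
  qed
  have dim: "homology_dim (induced X W) (int k - 1) \<le> 1" if L: "leray_number V X = k" "k \<ge> 2" for k W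
  proof -
    obtain n where n: "k = Suc n" "n \<ge> 1" using L(2) by (cases k) auto
    then show ?thesis using built_homology_dim[of n X W] bX L(1) by simp
  qed
  have witness2: "\<exists>W\<subseteq>V. \<not> homology_zero (induced X W) 1" if "leray_number V X = 2"
    using witness[OF that] by simp
  show ?thesis
    \<comment> \<open>Once \<open>M\<close> is rewritten as \<open>L\<close>, both sides of each
      equivalence contain the same equation, and only the additional conjunct needs proof.\<close>
    unfolding assms(3)[symmetric]
  proof (intro conjI allI impI)
    show "leray_number V X = 1 \<longleftrightarrow> leray_number V X = 1 \<and> \<not> is_simplex X" using simplex by blast
    show "leray_number V X = 2 \<longleftrightarrow> leray_number V X = 2 \<and> (\<exists>W\<subseteq>V. \<not> homology_zero (induced X W) 1)"
      using witness2 by blast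
    show "leray_number V X = k \<longleftrightarrow>
        leray_number V X = k \<and> (\<exists>W\<subseteq>V. \<not> homology_zero (induced X W) (int k - 1))" if "3 \<le> k" for k
      using witness[of k] that by auto
  qed (use cycle boundary dim in blast)+
qed

end
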